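(* Let $d$ be a positive integer. For any MIC $\{H_i\}_{i=1}^{d^2}$ in dimension $d$, let $\mathcal{P}=\{(\operatorname{tr}\rho H_1,\dots,\operatorname{tr}\rho H_{d^2}) : \rho\in\mathcal{Q}_d\}$ be the image of quantum state space $\mathcal{Q}_d$ under the Born Rule, and let $\mathrm{vol}_{\rm E}(\mathcal{P})$ be its Euclidean volume. Let $\mathcal{P}_{\rm SIC}$ denote the corresponding image for a SIC in dimension $d$. Then $$\mathrm{vol}_{\rm E}(\mathcal{P})\leq \mathrm{vol}_{\rm E}(\mathcal{P}_{\rm SIC}),$$ with equality if and only if the MIC $\{H_i\}$ is a SIC. Furthermore, $$\mathrm{vol}_{\rm E}(\mathcal{P}_{\rm SIC})=\sqrt{\frac{(2\pi)^{d(d-1)}}{d^{\,d^2-2}(d+1)^{d^2-1}}}\;\frac{\Gamma(1)\Gamma(2)\cdots\Gamma(d)}{\Gamma(d^2)}.$$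
   Context: A MIC (minimal informationally complete POVM) in dimension $d$ is a family $\{H_i\}_{i=1}^{d^2}$ of positive semidefinite operators on $\mathbb{C}^d$ with $\sum_i H_i=I$ that is a basis of the real vector space of Hermitian operators on $\mathbb{C}^d$. A SIC in dimension $d$ is a MIC $\{H_i\}_{i=1}^{d^2}$ for which every $H_i$ has rank $1$ and $\operatorname{tr} H_iH_j=\frac{1}{d^2}\,\frac{d\,\delta_{ij}+1}{d+1}$ for all $i,j$. Existence of SICs is not known in every dimension; the statement concerns any SIC in dimension $d$ (i.e. it holds for every choice of SIC used to define $\mathcal{P}_{\rm SIC}$). $\mathcal{Q}_d$ is the set of density operators (positive semidefinite operators of trace $1$) on $\mathbb{C}^d$. For a MIC, $\mathcal{P}$ is a convex subset of the $(d^2-1)$-dimensional probability simplex $\Delta\subset\mathbb{R}^{d^2}$. $\mathrm{vol}_{\rm E}$ denotes the $(d^2-1)$-dimensional Euclidean volume (hyperarea) within the hyperplane $\{p\in\mathbb{R}^{d^2}:\sum_i p_i=1\}$, with the metric induced from the standard Euclidean metric on $\mathbb{R}^{d^2}$ (so that, e.g., $\mathrm{vol}_{\rm E}(\Delta)=d/\Gamma(d^2)$). $\Gamma$ is the Gamma function. *)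

theory Defs
  imports "HOL-Analysis.Analysis"
begin

definition conj_transpose :: "complex^'n^'m \<Rightarrow> complex^'m^'n" where
  "conj_transpose A = (\<chi> i j. cnj (A $ j $ i))"

definition hermitian :: "complex^'n^'n \<Rightarrow> bool" where
  "hermitian A \<longleftrightarrow> conj_transpose A = A"

definition pos_semidef :: "complex^'n^'n \<Rightarrow> bool" where
  "pos_semidef A \<longleftrightarrow> hermitian A \<and> (\<forall>v. 0 \<le> Re (\<Sum>i\<in>UNIV. cnj (v $ i) * (A *v v) $ i))"

definition density_operators :: "(complex^'n^'n) set" where
  "density_operators = {\<rho>. pos_semidef \<rho> \<and> trace \<rho> = 1}"

text \<open>The dimension is \<open>d = CARD('n)\<close>, and \<open>'m\<close> is an index type with \<open>d\<^sup>2\<close> elements.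
  The constants \<^const>\<open>independent\<close> and \<^const>\<open>span\<close> refer to real scalars.\<close>

definition is_MIC :: "('m::finite \<Rightarrow> complex^'n^'n) \<Rightarrow> bool" where
  "is_MIC H \<longleftrightarrow> CARD('m) = CARD('n)\<^sup>2
     \<and> (\<forall>i. pos_semidef (H i)) \<and> (\<Sum>i\<in>UNIV. H i) = mat 1
     \<and> inj H \<and> independent (range H) \<and> span (range H) = {A. hermitian A}"

definition is_SIC :: "('m::finite \<Rightarrow> complex^'n^'n) \<Rightarrow> bool" where
  "is_SIC H \<longleftrightarrow> is_MIC H \<and> (\<forall>i. rank (H i) = 1)
     \<and> (\<forall>i j. trace (H i ** H j) =
          1 / of_nat (CARD('n)\<^sup>2) *
          ((of_nat CARD('n) * (if i = j then 1 else 0) + 1) / (of_nat CARD('n) + 1)))"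

text \<open>The trace of a product of two Hermitian matrices is real, so \<^const>\<open>Re\<close> below only changes
  the type.\<close>

definition born_image :: "('m::finite \<Rightarrow> complex^'n^'n) \<Rightarrow> (real^'m) set" where
  "born_image H = (\<lambda>\<rho>. \<chi> i. Re (trace (\<rho> ** H i))) ` density_operators"

text \<open>Orthonormal bases \<open>b 0, \<dots>, b (N - 2)\<close> of the direction space \<open>{x. \<Sum>k. x $ k = 0}\<close>, which has
  dimension \<open>N - 1\<close> for \<open>N = CARD('m)\<close>.\<close>

definition orthonormal_frame :: "(nat \<Rightarrow> real^'m) \<Rightarrow> bool" where
  "orthonormal_frame b \<longleftrightarrow>
     (\<forall>i < CARD('m) - 1. (\<Sum>k\<in>UNIV. b i $ k) = 0) \<and>
     (\<forall>i < CARD('m) - 1. \<forall>j < CARD('m) - 1. b i \<bullet> b j = (if i = j then 1 else 0))"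

lemma orthonormal_frame_exists: "\<exists>b :: nat \<Rightarrow> real^'m. orthonormal_frame b"
proof -
  let ?u = "1 :: real^'m"
  let ?S = "{x. ?u \<bullet> x = 0}"
  have "subspace ?S"
    by (rule subspace_hyperplane)
  then obtain B where B: "B \<subseteq> ?S" "pairwise orthogonal B" "\<And>x. x \<in> B \<Longrightarrow> norm x = 1"
    "independent B" "card B = dim ?S"
    by (rule orthonormal_basis_subspace) blast
  have "?u \<noteq> 0"
    by (simp add: vec_eq_iff)
  then have "card B = CARD('m) - 1"
    using B(5) dim_hyperplane[of ?u] by simp
  moreover have "finite B"
    using B(4) by (rule independent_imp_finite)
  ultimately obtain b where b: "bij_betw b {0..<CARD('m) - 1} B"
    using ex_bij_betw_nat_finite by metis
  have mem: "b i \<in> B" if "i < CARD('m) - 1" for i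
    using b that by (auto simp: bij_betw_def)
  have inj: "b i = b j \<longleftrightarrow> i = j" if "i < CARD('m) - 1" "j < CARD('m) - 1" for i j
    using b that by (auto simp: bij_betw_def inj_on_def)
  have "(\<Sum>k\<in>UNIV. b i $ k) = 0" if "i < CARD('m) - 1" for i
    using mem[OF that] B(1) by (auto simp: inner_vec_def)
  moreover have "b i \<bullet> b j = (if i = j then 1 else 0)"
    if "i < CARD('m) - 1" "j < CARD('m) - 1" for i j
    using mem[OF that(1)] mem[OF that(2)] inj[OF that] B(2) B(3)[of "b i"]
    by (auto simp: pairwise_def orthogonal_def norm_eq_1)
  ultimately have "orthonormal_frame b"
    unfolding orthonormal_frame_def by blast
  then show ?thesis
    by blast
qed

text \<open>Volume of a Borel subset of the hyperplane \<open>{p. \<Sum>k. p $ k = 1}\<close> of \<open>real^'m\<close> for the metric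
  induced from \<open>real^'m\<close>, i.e. its \<open>(N - 1)\<close>-dimensional Lebesgue measure in the isometric
  coordinates \<open>x \<mapsto> barycenter + (\<Sum>i < N - 1. x i *\<^sub>R b i)\<close>, where \<open>N = CARD('m)\<close>. By invariance of
  Lebesgue measure under isometries it does not depend on the frame chosen. The coordinates are
  extensional functions on \<open>{..<N - 1}\<close> because \<open>real^'k\<close> has no counterpart of dimension \<open>0\<close>,
  which is the case \<open>N = 1\<close>; the volume of the point is then \<open>1\<close>.\<close>

definition vol_E :: "(real^'m) set \<Rightarrow> real" where
  "vol_E P =
     (let N = CARD('m); b = (SOME b :: nat \<Rightarrow> real^'m. orthonormal_frame b)
      in measure (Pi\<^sub>M {..<N - 1} (\<lambda>_. lborel :: real measure))
           {x \<in> {..<N - 1} \<rightarrow>\<^sub>E UNIV.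
              (\<chi> k. 1 / real N) + (\<Sum>i<N - 1. x i *\<^sub>R b i) \<in> P})"

end

theory Submission
  imports Defs "HOL-Probability.Distributions"
begin

text \<open>The integral of \<open>exp (- \<Sum>p)\<close> over the cone spanned by \<open>born_image H\<close> can be evaluated in two ways.
  Slicing along the barycentric direction gives a multiple of \<open>vol_E (born_image H)\<close>; pulling back to
  Hermitian matrices gives the integral of \<open>exp (- trace X)\<close> over positive semidefinite \<open>X\<close> times
  the Jacobian of the Born map, which is a constant times \<open>sqrt (det G)\<close> for the Gram matrix
  \<open>G\<close> of \<open>H\<close>. The integral over positive semidefinite matrices follows by induction on the size:
  the Schur complement of the corner entry \<open>a\<close> is a translation of the remaining block, and the last
  column contributes a Gaussian integral \<open>(pi * a) ^ n\<close>. Finally \<open>det G\<close> is maximal exactly for SICs, by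
  the arithmetic-geometric mean inequality for the eigenvalues of a normalized Gram matrix together
  with \<open>tr H\<^sub>i\<^sup>2 \<le> (tr H\<^sub>i)\<^sup>2\<close>.\<close>

section \<open>Linear changes of variables\<close>

text \<open>\<open>vol_E\<close> measures a set of dimension N - 1 in \<open>real^'m\<close>, where
  N = CARD('m) = d^2. The cone over it is full-dimensional, so an ordinary square determinant serves
  as Jacobian, and a frame chosen by \<open>SOME\<close> is harmless because orthonormal bases have
  determinant 1 or -1. The weight suits both evaluations: it is constant on each slice, and it turns
  into exp (- trace X) because the \<open>H i\<close> sum to the identity. Origin of the constants:
  the radial integral of t^(N-1) exp (- t) gives Gamma(d^2), the corner entries give k! for k < d,
  the last columns give the powers of pi, and the double weight of off-diagonal entries gives the
  power of 2. The powers of d and d + 1 come from the Gram determinant of a SIC and from sqrt N = d.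
  For the maximum, the normalized Gram matrix has one eigenvalue fixed at 1 and trace at most d, so
  the other d^2 - 1 eigenvalues have mean at most 1 / (d + 1). Undoing the normalization leaves the
  product of the traces of the \<open>H i\<close>, whose sum is d; a second mean inequality bounds
  it.\<close>

interpretation lborel_prod: product_sigma_finite "\<lambda>_. lborel :: real measure"
  by standard

lemma measurable_PiM_lborel_vec:
  fixes e :: "'m::finite \<Rightarrow> 'k"
  assumes "\<And>i. e i \<in> K"
  shows "(\<lambda>x. \<chi> i. x (e i)) \<in> Pi\<^sub>M K (\<lambda>_. lborel) \<rightarrow>\<^sub>M (borel :: (real^'m) measure)"
proof (rule borel_measurable_euclidean_space[THEN iffD2], intro ballI)
  fix b :: "real^'m"
  assume "b \<in> Basis"
  then obtain i where b: "b = axis i 1"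
    by (auto simp: Basis_vec_def)
  show "(\<lambda>x. (\<chi> i. x (e i)) \<bullet> b) \<in> borel_measurable (Pi\<^sub>M K (\<lambda>_. lborel))"
    using measurable_component_singleton[of "e i" K "\<lambda>_. lborel :: real measure"] assms
    by (simp add: b inner_axis)
qed

text \<open>Both measures give a box the product of its side lengths. The index set \<open>K\<close>
  is left open because two are needed: an initial segment of the naturals for orthonormal frames,
  and index pairs for Hermitian matrices.\<close>

lemma distr_PiM_lborel_vec:
  fixes e :: "'m::finite \<Rightarrow> 'k"
  assumes e: "bij_betw e UNIV K"
  shows "distr (Pi\<^sub>M K (\<lambda>_. lborel)) borel (\<lambda>x. \<chi> i. x (e i)) = (lborel :: (real^'m) measure)"
proof (rule lborel_eqI[symmetric])
  have K: "finite K" "e i \<in> K" for i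
    using bij_betw_finite[OF e] e by (auto simp: bij_betw_def)
  note [measurable] = measurable_PiM_lborel_vec[of e K, OF K(2)]
  fix l u :: "real^'m"
  assume le: "\<And>b. b \<in> Basis \<Longrightarrow> l \<bullet> b \<le> u \<bullet> b"
  define e' where "e' = the_inv e"
  have e': "e' (e i) = i" for i
    using e by (simp add: e'_def bij_betw_def the_inv_f_f)
  have le': "l $ i \<le> u $ i" for i
    using le[of "axis i 1"] by (simp add: inner_axis)
  have "(\<lambda>x. \<chi> i. x (e i)) -` box l u \<inter> space (Pi\<^sub>M K (\<lambda>_. lborel))
      = Pi\<^sub>E K (\<lambda>k. {l $ e' k <..< u $ e' k})"
  proof -
    have K_all: "(\<forall>k\<in>K. Q k) \<longleftrightarrow> (\<forall>i. Q (e i))" for Q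
      using e by (auto simp: bij_betw_def)
    show ?thesis
      unfolding set_eq_iff PiE_iff K_all by (simp add: mem_box_cart space_PiM PiE_iff K_all e' conj_commute)
  qed
  then have "emeasure (distr (Pi\<^sub>M K (\<lambda>_. lborel)) borel (\<lambda>x. \<chi> i. x (e i))) (box l u)
      = (\<Prod>k\<in>K. emeasure lborel {l $ e' k <..< u $ e' k})"
    using K(1) by (simp add: emeasure_distr lborel_prod.emeasure_PiM)
  also have "\<dots> = (\<Prod>i\<in>UNIV. ennreal (u $ i - l $ i))"
    by (rule prod.reindex_bij_betw[OF e, symmetric, THEN trans]) (simp add: e' le')
  also have "\<dots> = ennreal (\<Prod>i\<in>UNIV. (u - l) \<bullet> axis i 1)"
    using le' by (simp add: prod_ennreal inner_axis)
  also have "(\<Prod>i\<in>UNIV. (u - l) \<bullet> axis i 1) = (\<Prod>b\<in>Basis. (u - l) \<bullet> b)"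
    by (rule prod.reindex_bij_betw)
       (auto simp: bij_betw_def inj_on_def Basis_vec_def axis_eq_axis)
  finally show "emeasure (distr (Pi\<^sub>M K (\<lambda>_. lborel)) borel (\<lambda>x. \<chi> i. x (e i))) (box l u)
      = (\<Prod>b\<in>Basis. (u - l) \<bullet> b)" .
qed simp

lemma nn_integral_lborel_vec:
  fixes f :: "real^'m \<Rightarrow> ennreal"
  assumes e: "bij_betw e UNIV K" and [measurable]: "f \<in> borel_measurable borel"
  shows "integral\<^sup>N lborel f = (\<integral>\<^sup>+x. f (\<chi> i. x (e i)) \<partial>Pi\<^sub>M K (\<lambda>_. lborel))"
proof -
  have "e i \<in> K" for i
    using e by (auto simp: bij_betw_def)
  then have "integral\<^sup>N (distr (Pi\<^sub>M K (\<lambda>_. lborel)) borel (\<lambda>x. \<chi> i. x (e i))) f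
      = (\<integral>\<^sup>+x. f (\<chi> i. x (e i)) \<partial>Pi\<^sub>M K (\<lambda>_. lborel))"
    by (intro nn_integral_distr measurable_PiM_lborel_vec) auto
  then show ?thesis
    by (simp only: distr_PiM_lborel_vec[OF e])
qed

text \<open>An affine map acting coordinatewise sends rectangles to rectangles, and these determine
  the product measure. It is used for the dilation of a slice (\<open>c\<close> = 0) and for the
  translation to a Schur complement (\<open>t\<close> = 1). An empty \<open>K\<close> is allowed and
  does occur, for N = 1.\<close>

lemma nn_integral_PiM_affine:
  fixes c t :: "'k \<Rightarrow> real"
  assumes K: "finite K" and t: "\<And>k. k \<in> K \<Longrightarrow> t k \<noteq> 0"
    and f: "f \<in> borel_measurable (Pi\<^sub>M K (\<lambda>_. lborel))"
  shows "integral\<^sup>N (Pi\<^sub>M K (\<lambda>_. lborel)) f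
    = (\<Prod>k\<in>K. ennreal \<bar>t k\<bar>) * (\<integral>\<^sup>+x. f (\<lambda>k\<in>K. c k + t k * x k) \<partial>Pi\<^sub>M K (\<lambda>_. lborel))"
proof -
  let ?P = "Pi\<^sub>M K (\<lambda>_. lborel :: real measure)" and ?T = "\<lambda>x. \<lambda>k\<in>K. c k + t k * x k"
  let ?c = "\<Prod>k\<in>K. ennreal \<bar>t k\<bar>"
  have T: "?T \<in> ?P \<rightarrow>\<^sub>M ?P"
    by measurable
  have "density (distr ?P ?P ?T) (\<lambda>_. ?c) = ?P"
  proof (rule lborel_prod.PiM_eqI[OF K])
    fix A :: "'k \<Rightarrow> real set"
    assume A: "\<And>k. k \<in> K \<Longrightarrow> A k \<in> sets lborel"
    let ?B = "\<lambda>k. (\<lambda>y. c k + t k * y) -` A k"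
    have B: "?B k \<in> sets borel" if "k \<in> K" for k
      using A[OF that] by (intro measurable_sets_borel[where M=borel]) auto
    have fac: "ennreal \<bar>t k\<bar> * emeasure lborel (?B k) = emeasure lborel (A k)" if k: "k \<in> K" for k
    proof -
      have "emeasure lborel (A k) = (\<integral>\<^sup>+x. indicator (A k) x \<partial>lborel)"
        using A[OF k] by simp
      also have "\<dots> = \<bar>t k\<bar> * (\<integral>\<^sup>+x. indicator (A k) (c k + t k * x) \<partial>lborel)"
        using A[OF k] t[OF k] by (intro nn_integral_real_affine) auto
      also have "(\<lambda>x. indicator (A k) (c k + t k * x) :: ennreal) = indicator (?B k)"
        by (auto simp: fun_eq_iff indicator_def)
      finally show ?thesis
        using B[OF k] by simp
    qed
    have "?T -` Pi\<^sub>E K A \<inter> space ?P = Pi\<^sub>E K ?B"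
      by (auto simp: space_PiM PiE_def Pi_def extensional_def)
    then have "emeasure (distr ?P ?P ?T) (Pi\<^sub>E K A) = (\<Prod>k\<in>K. emeasure lborel (?B k))"
      using A B K by (subst emeasure_distr[OF T]) (simp_all add: lborel_prod.emeasure_PiM sets_PiM_I_finite)
    moreover have "Pi\<^sub>E K A \<in> sets ?P"
      using A K by (simp add: sets_PiM_I_finite)
    ultimately have "emeasure (density (distr ?P ?P ?T) (\<lambda>_. ?c)) (Pi\<^sub>E K A)
        = ?c * (\<Prod>k\<in>K. emeasure lborel (?B k))"
      by (subst emeasure_density_const) simp_all
    also have "\<dots> = (\<Prod>k\<in>K. emeasure lborel (A k))"
      unfolding prod.distrib[symmetric] by (intro prod.cong fac refl)
    finally show "emeasure (density (distr ?P ?P ?T) (\<lambda>_. ?c)) (Pi\<^sub>E K A)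
        = (\<Prod>k\<in>K. emeasure lborel (A k))" .
  qed (simp only: sets_density sets_distr)
  then have "integral\<^sup>N ?P f = integral\<^sup>N (density (distr ?P ?P ?T) (\<lambda>_. ?c)) f"
    by simp
  also have "\<dots> = (\<integral>\<^sup>+x. ?c * f x \<partial>distr ?P ?P ?T)"
    by (rule nn_integral_density) (simp_all add: f)
  also have "\<dots> = ?c * integral\<^sup>N (distr ?P ?P ?T) f"
    by (rule nn_integral_cmult) (simp only: measurable_distr_eq1 f)
  also have "\<dots> = ?c * (\<integral>\<^sup>+x. f (?T x) \<partial>?P)"
    by (subst nn_integral_distr[OF T]) (simp_all add: f)
  finally show ?thesis .
qed

text \<open>Every linear map is built from elementary ones by composition: diagonal maps are handled
  by \<open>nn_integral_PiM_affine\<close>, coordinate swaps by renumbering the product, and shears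
  by Fubini.\<close>

lemma nn_integral_lborel_linear:
  fixes f :: "real^'m \<Rightarrow> real^'m"
  assumes "linear f" "det (matrix f) \<noteq> 0" "g \<in> borel_measurable borel"
  shows "integral\<^sup>N lborel g = ennreal \<bar>det (matrix f)\<bar> * (\<integral>\<^sup>+x. g (f x) \<partial>lborel)"
proof -
  let ?P = "Pi\<^sub>M UNIV (\<lambda>_::'m. lborel :: real measure)"
  have tr: "integral\<^sup>N lborel g = (\<integral>\<^sup>+x. g (\<chi> i. x i) \<partial>?P)"
    if "g \<in> borel_measurable borel" for g :: "real^'m \<Rightarrow> ennreal"
    using nn_integral_lborel_vec[OF bij_betw_id that] by simp
  have meas: "h \<in> borel_measurable borel" if "linear h" for h :: "real^'m \<Rightarrow> real^'m"
    using that by (intro borel_measurable_continuous_onI linear_continuous_on) (simp add: linear_linear)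
  have [measurable]: "(\<lambda>x. g (\<chi> i. x i)) \<in> borel_measurable ?P"
    if "g \<in> borel_measurable borel" for g :: "real^'m \<Rightarrow> ennreal"
    using measurable_compose[OF measurable_PiM_lborel_vec[of "\<lambda>i. i" UNIV] that] by simp
  \<comment> \<open>Nonsingularity is part of \<open>P\<close>, since the induction also meets
    singular maps. A nonsingular composition has nonsingular factors, and the case of a zero row
    becomes vacuous.\<close>
  define P where "P f \<longleftrightarrow> (\<forall>g :: real^'m \<Rightarrow> ennreal. g \<in> borel_measurable borel \<longrightarrow> det (matrix f) \<noteq> 0 \<longrightarrow>
      integral\<^sup>N lborel g = ennreal \<bar>det (matrix f)\<bar> * (\<integral>\<^sup>+x. g (f x) \<partial>lborel))"
    for f :: "real^'m \<Rightarrow> real^'m"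
  have PI: "P f" if "\<And>g :: real^'m \<Rightarrow> ennreal. g \<in> borel_measurable borel \<Longrightarrow> det (matrix f) \<noteq> 0 \<Longrightarrow>
      integral\<^sup>N lborel g = ennreal \<bar>det (matrix f)\<bar> * (\<integral>\<^sup>+x. g (f x) \<partial>lborel)" for f
    using that by (simp add: P_def)
  have "P f"
  proof (rule induct_linear_elementary[OF \<open>linear f\<close>]; rule PI)
    fix f h :: "real^'m \<Rightarrow> real^'m" and g :: "real^'m \<Rightarrow> ennreal"
    assume 1: "linear f" "linear h" "P f" "P h" "g \<in> borel_measurable borel"
      "det (matrix (f \<circ> h)) \<noteq> 0"
    have "det (matrix f) \<noteq> 0" "det (matrix h) \<noteq> 0"
      using 1 by (auto simp: matrix_compose det_mul)
    have gf: "(\<lambda>x. g (f x)) \<in> borel_measurable borel"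
      using meas[OF \<open>linear f\<close>] 1(5) by measurable
    show "integral\<^sup>N lborel g
        = ennreal \<bar>det (matrix (f \<circ> h))\<bar> * (\<integral>\<^sup>+x. g ((f \<circ> h) x) \<partial>lborel)"
    proof -
      have "(\<integral>\<^sup>+x. g (f x) \<partial>lborel) = ennreal \<bar>det (matrix h)\<bar> * (\<integral>\<^sup>+x. g (f (h x)) \<partial>lborel)"
        using 1(4) \<open>det (matrix h) \<noteq> 0\<close> gf unfolding P_def by blast
      moreover have "integral\<^sup>N lborel g = ennreal \<bar>det (matrix f)\<bar> * (\<integral>\<^sup>+x. g (f x) \<partial>lborel)"
        using 1(3,5) \<open>det (matrix f) \<noteq> 0\<close> unfolding P_def by blast
      ultimately show ?thesis
        using 1(1,2) by (simp add: matrix_compose det_mul abs_mult ennreal_mult mult.assoc)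
    qed
  next
    fix f :: "real^'m \<Rightarrow> real^'m" and i and g :: "real^'m \<Rightarrow> ennreal"
    assume 2: "linear f" "\<And>x. f x $ i = 0" "det (matrix f) \<noteq> 0"
    then have "row i (matrix f) = 0"
      by (simp add: row_def matrix_def vec_eq_iff)
    then show "integral\<^sup>N lborel g = ennreal \<bar>det (matrix f)\<bar> * (\<integral>\<^sup>+x. g (f x) \<partial>lborel)"
      using 2 det_zero_row by blast
  next
    fix c :: "'m \<Rightarrow> real" and g :: "real^'m \<Rightarrow> ennreal"
    let ?h = "\<lambda>x::real^'m. \<chi> i. c i * x $ i"
    assume 3: "g \<in> borel_measurable borel" "det (matrix ?h) \<noteq> 0"
    have det: "det (matrix ?h) = (\<Prod>i\<in>UNIV. c i)"
      by (subst det_diagonal) (auto simp: matrix_def axis_def)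
    then have c: "c i \<noteq> 0" for i
      using 3 by auto
    have lin: "linear ?h"
      by (rule linearI) (auto simp: vec_eq_iff algebra_simps)
    have "integral\<^sup>N lborel g = (\<Prod>i\<in>UNIV. ennreal \<bar>c i\<bar>) * (\<integral>\<^sup>+x. g (\<chi> i. c i * x i) \<partial>?P)"
      using nn_integral_PiM_affine[of UNIV c "\<lambda>x. g (\<chi> i. x i)" "\<lambda>_. 0"] c 3
      by (simp add: tr)
    then show "integral\<^sup>N lborel g = ennreal \<bar>det (matrix ?h)\<bar> * (\<integral>\<^sup>+x. g (?h x) \<partial>lborel)"
      using 3 meas[OF lin] by (subst (2) tr) (auto simp: det prod_ennreal abs_prod)
  next
    fix m n :: 'm and g :: "real^'m \<Rightarrow> ennreal"
    assume mn: "m \<noteq> n"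
    let ?h = "\<lambda>x::real^'m. \<chi> i. x $ Transposition.transpose m n i"
    assume 4: "g \<in> borel_measurable borel"
    have lin: "linear ?h"
      by (rule linearI) (auto simp: vec_eq_iff)
    have "matrix ?h = transpose (\<chi> i. mat 1 $ Transposition.transpose m n i)"
      by (auto simp: matrix_def transpose_def mat_def axis_def vec_eq_iff transpose_eq_iff)
    then have det: "\<bar>det (matrix ?h)\<bar> = 1"
      by (simp add: det_permute_rows permutes_swap_id sign_swap_id)
    have "integral\<^sup>N lborel g = (\<integral>\<^sup>+x. g (\<chi> i. x (Transposition.transpose m n i)) \<partial>?P)"
      using 4 by (intro nn_integral_lborel_vec) auto
    also have "\<dots> = (\<integral>\<^sup>+x. g (?h x) \<partial>lborel)"
      using 4 meas[OF lin] by (subst tr) auto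
    finally show "integral\<^sup>N lborel g = ennreal \<bar>det (matrix ?h)\<bar> * (\<integral>\<^sup>+x. g (?h x) \<partial>lborel)"
      by (simp add: det)
  next
    fix m n :: 'm and g :: "real^'m \<Rightarrow> ennreal"
    assume mn: "m \<noteq> n"
    let ?h = "\<lambda>x::real^'m. \<chi> i. if i = m then x $ m + x $ n else x $ i"
    assume 5: "g \<in> borel_measurable borel"
    have lin: "linear ?h"
      by (rule linearI) (auto simp: vec_eq_iff algebra_simps)
    have "matrix ?h = (\<chi> k. if k = m then row m (mat 1) + 1 *s row n (mat 1) else row k (mat 1))"
      by (auto simp: matrix_def mat_def axis_def row_def vec_eq_iff)
    then have det: "det (matrix ?h) = 1"
      using det_row_operation[OF mn, of "mat 1" 1] by simp
    \<comment> \<open>Coordinate \<open>m\<close> is integrated first: with the others fixed, the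
      shear only translates it by \<open>x n\<close>.\<close>
    let ?Q = "Pi\<^sub>M (UNIV - {m}) (\<lambda>_::'m. lborel :: real measure)"
    have U: "insert m (UNIV - {m}) = (UNIV :: 'm set)"
      by auto
    have "integral\<^sup>N lborel g = (\<integral>\<^sup>+x. (\<integral>\<^sup>+y. g (\<chi> i. (x(m := y)) i) \<partial>lborel) \<partial>?Q)"
      using lborel_prod.product_nn_integral_insert[of "UNIV - {m}" m "\<lambda>x. g (\<chi> i. x i)"] 5
      by (simp add: tr U)
    also have "\<dots> = (\<integral>\<^sup>+x. (\<integral>\<^sup>+y. g (?h (\<chi> i. (x(m := y)) i)) \<partial>lborel) \<partial>?Q)"
    proof (rule nn_integral_cong)
      fix x :: "'m \<Rightarrow> real"
      assume "x \<in> space ?Q"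
      have "(\<lambda>y. \<chi> i. (x(m := y)) i) \<in> borel \<rightarrow>\<^sub>M (borel :: (real^'m) measure)"
      proof (rule borel_measurable_continuous_onI)
        show "continuous_on UNIV (\<lambda>y. \<chi> i. (x(m := y)) i)"
        proof (rule continuous_on_vec_lambda)
          show "continuous_on UNIV (\<lambda>y. (x(m := y)) i)" for i
            by (cases "i = m") auto
        qed
      qed
      then have "(\<lambda>y. g (\<chi> i. (x(m := y)) i)) \<in> borel_measurable borel"
        using 5 by measurable
      then have "(\<integral>\<^sup>+y. g (\<chi> i. (x(m := y)) i) \<partial>lborel) = (\<integral>\<^sup>+y. g (\<chi> i. (x(m := x n + 1 * y)) i) \<partial>lborel)"
        using nn_integral_real_affine[of "\<lambda>y. g (\<chi> i. (x(m := y)) i)" 1 "x n"] by simp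
      also have "(\<lambda>y. \<chi> i. (x(m := x n + 1 * y)) i) = (\<lambda>y. ?h (\<chi> i. (x(m := y)) i))"
        using mn by (auto simp: fun_eq_iff vec_eq_iff)
      then have "(\<integral>\<^sup>+y. g (\<chi> i. (x(m := x n + 1 * y)) i) \<partial>lborel) = (\<integral>\<^sup>+y. g (?h (\<chi> i. (x(m := y)) i)) \<partial>lborel)"
        by metis
      finally show "(\<integral>\<^sup>+y. g (\<chi> i. (x(m := y)) i) \<partial>lborel) = (\<integral>\<^sup>+y. g (?h (\<chi> i. (x(m := y)) i)) \<partial>lborel)" .
    qed
    also have "\<dots> = (\<integral>\<^sup>+x. g (?h x) \<partial>lborel)"
      using lborel_prod.product_nn_integral_insert[of "UNIV - {m}" m "\<lambda>x. g (?h (\<chi> i. x i))"] 5 meas[OF lin]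
      by (simp add: tr U)
    finally show "integral\<^sup>N lborel g = ennreal \<bar>det (matrix ?h)\<bar> * (\<integral>\<^sup>+x. g (?h x) \<partial>lborel)"
      by (simp add: det)
  qed
  then show ?thesis
    using assms by (simp add: P_def)
qed

text \<open>The form in which the change of variables is applied, once to an orthonormal basis
  adapted to the slices and once to the images of the coordinate matrices under the Born
  map.\<close>

lemma nn_integral_lborel_basis:
  fixes B :: "'k \<Rightarrow> real^'m"
  assumes e: "bij_betw e UNIV K" and f: "f \<in> borel_measurable borel"
    and det: "det (\<chi> i j. B (e j) $ i) \<noteq> 0"
  shows "integral\<^sup>N lborel f = ennreal \<bar>det (\<chi> i j. B (e j) $ i)\<bar>
    * (\<integral>\<^sup>+x. f (\<Sum>k\<in>K. x k *\<^sub>R B k) \<partial>Pi\<^sub>M K (\<lambda>_. lborel))"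
proof -
  let ?M = "\<chi> i j. B (e j) $ i"
  have "(\<lambda>x. f (?M *v x)) \<in> borel_measurable borel"
    using f by (intro measurable_compose[OF _ f] borel_measurable_continuous_onI linear_continuous_on)
      (simp add: linear_linear)
  then have "(\<integral>\<^sup>+x. f (?M *v x) \<partial>lborel) = (\<integral>\<^sup>+x. f (?M *v (\<chi> i. x (e i))) \<partial>Pi\<^sub>M K (\<lambda>_. lborel))"
    by (rule nn_integral_lborel_vec[OF e])
  also have "(\<lambda>x. ?M *v (\<chi> i. x (e i))) = (\<lambda>x. \<Sum>k\<in>K. x k *\<^sub>R B k)"
    by (subst sum.reindex_bij_betw[OF e, symmetric])
       (simp add: fun_eq_iff vec_eq_iff matrix_vector_mult_def mult.commute)
  finally show ?thesis
    by (subst nn_integral_lborel_linear[of "(*v) ?M" f, OF matrix_vector_mul_linear _ f])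
       (simp_all only: matrix_of_matrix_vector_mul det not_False_eq_True)
qed

section \<open>Slices of a cone\<close>

text \<open>Substituting s = c y leaves the integral for Gamma(n + 1). The value c = sqrt N belongs
  to the slices of the cone, c = 1 to the corner entry of a matrix.\<close>

lemma nn_integral_exp_scaled:
  fixes c :: real
  assumes "0 < c"
  shows "(\<integral>\<^sup>+y. indicator {0<..} y * ennreal (exp (- (c * y)) * (c * y) ^ n) \<partial>lborel) = ennreal (fact n / c)"
proof -
  have "(\<integral>\<^sup>+y. indicator {0<..} y * ennreal (exp (- (c * y)) * (c * y) ^ n) \<partial>lborel)
      = ennreal (1 / c) * (\<integral>\<^sup>+s. indicator {0<..} (s / c) * ennreal (exp (- s) * s ^ n) \<partial>lborel)"
    using nn_integral_real_affine[of "\<lambda>y. indicator {0<..} y * ennreal (exp (- (c * y)) * (c * y) ^ n)" "1 / c" 0]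
      assms by simp
  also have "(\<integral>\<^sup>+s. indicator {0<..} (s / c) * ennreal (exp (- s) * s ^ n) \<partial>lborel)
      = (\<integral>\<^sup>+s. ennreal (s ^ n * exp (- s)) * indicator {0..} s \<partial>lborel)"
  \<comment> \<open>The open and the closed half-line differ at 0, where the integrands disagree if
    n = 0.\<close>
  proof (rule nn_integral_cong_AE)
    show "AE s in lborel. indicator {0<..} (s / c) * ennreal (exp (- s) * s ^ n)
        = ennreal (s ^ n * exp (- s)) * indicator {0..} s"
      using AE_lborel_singleton[of 0]
      by eventually_elim (use assms in \<open>auto simp: indicator_def zero_less_divide_iff mult.commute\<close>)
  qed
  also have "\<dots> = ennreal (fact n)"
    by (simp add: nn_intergal_power_times_exp_Ici)
  finally show ?thesis
    using assms by (simp add: ennreal_mult'[symmetric])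
qed

text \<open>The slice of \<open>C\<close> at coordinate sum t > 0 is t times \<open>P\<close>, of
  volume t^(N-1) times that of \<open>P\<close>. Along the unit normal of the slices t = sqrt N * y,
  so the radial integral is (N - 1)! / sqrt N.\<close>

lemma vol_E_cone:
  fixes P C :: "(real^'m) set"
  assumes C: "C \<in> sets borel"
    and pos: "\<And>p. p \<in> C \<Longrightarrow> 0 \<le> (\<Sum>k\<in>UNIV. p $ k)"
    and slice: "\<And>p t. 0 < t \<Longrightarrow> (\<Sum>k\<in>UNIV. p $ k) = 1 \<Longrightarrow> t *\<^sub>R p \<in> C \<longleftrightarrow> p \<in> P"
  shows "enn2real (\<integral>\<^sup>+p. indicator C p * ennreal (exp (- (\<Sum>k\<in>UNIV. p $ k))) \<partial>lborel)
    = fact (CARD('m) - 1) / sqrt CARD('m) * vol_E P"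
proof -
  define N where "N = CARD('m)"
  have N: "0 < N"
    by (simp add: N_def)
  define b where "b = (SOME b :: nat \<Rightarrow> real^'m. orthonormal_frame b)"
  have "orthonormal_frame b"
    unfolding b_def by (rule someI_ex[OF orthonormal_frame_exists])
  then have b0: "\<And>i. i < N - 1 \<Longrightarrow> (\<Sum>k\<in>UNIV. b i $ k) = 0"
    and b1: "\<And>i j. i < N - 1 \<Longrightarrow> j < N - 1 \<Longrightarrow> b i \<bullet> b j = (if i = j then 1 else 0)"
    by (auto simp: orthonormal_frame_def N_def)
  \<comment> \<open>\<open>u\<close> is the unit normal of the slices. It takes the free index N - 1
    and completes the frame to an orthonormal basis of the whole space.\<close>
  define u :: "real^'m" where "u = (\<chi> i. 1 / sqrt N)"
  define B where "B k = (if k < N - 1 then b k else u)" for k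
  define J where "J = {..<N - 1}"
  let ?PJ = "Pi\<^sub>M J (\<lambda>_. lborel :: real measure)"
  have ins: "{..<N} = insert (N - 1) J" "N - 1 \<notin> J" "finite J"
    using N by (auto simp: J_def)
  have sum_comb: "(\<Sum>k\<in>UNIV. (\<Sum>i\<in>J. x i *\<^sub>R b i) $ k) = 0" for x
    unfolding sum_component by (subst sum.swap) (simp add: J_def b0 sum_distrib_left[symmetric])
  have B1: "B i \<bullet> B j = (if i = j then 1 else 0)" if "i < N" "j < N" for i j
  proof -
    have "b i \<bullet> u = 0" if "i < N - 1" for i
      using b0[OF that] by (simp add: u_def inner_vec_def sum_divide_distrib[symmetric])
    moreover have "u \<bullet> u = 1"
      using N by (simp add: u_def inner_vec_def N_def)
    ultimately show ?thesis
      using that b1 by (auto simp: B_def inner_commute)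
  qed
  obtain e :: "'m \<Rightarrow> nat" where e: "bij_betw e UNIV {..<N}"
    using ex_bij_betw_finite_nat[of "UNIV :: 'm set"] by (auto simp: N_def atLeast0LessThan)
  have eN: "e i < N" and e_inj: "e i = e j \<longleftrightarrow> i = j" for i j
    using e by (auto simp: bij_betw_def inj_on_def)
  let ?M = "\<chi> i j. B (e j) $ i"
  have "transpose ?M ** ?M = mat 1"
    using B1[OF eN eN]
    by (simp add: matrix_matrix_mult_def transpose_def mat_def inner_vec_def vec_eq_iff e_inj)
  then have "orthogonal_matrix ?M"
    by (simp add: orthogonal_matrix)
  then have det: "det ?M = 1 \<or> det ?M = -1"
    by (rule det_orthogonal_matrix)
  define f where "f p = indicator C p * ennreal (exp (- (\<Sum>k\<in>UNIV. p $ k)))" for p :: "real^'m"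
  have f: "f \<in> borel_measurable borel"
    unfolding f_def using C by measurable
  define S where "S = {x \<in> J \<rightarrow>\<^sub>E UNIV. (\<chi> k. 1 / real N) + (\<Sum>i\<in>J. x i *\<^sub>R b i) \<in> P}"
  have S_iff: "x \<in> S \<longleftrightarrow> t *\<^sub>R ((\<chi> k. 1 / real N) + (\<Sum>i\<in>J. x i *\<^sub>R b i)) \<in> C"
    if "x \<in> J \<rightarrow>\<^sub>E UNIV" "0 < t" for x t
    using that slice[OF that(2), of "(\<chi> k. 1 / real N) + (\<Sum>i\<in>J. x i *\<^sub>R b i)"] N
    by (simp add: S_def sum.distrib sum_comb N_def del: sum_component)
  \<comment> \<open>\<open>P\<close> is known only through the slices of \<open>C\<close>, so
    measurability of \<open>S\<close> is obtained from the Borel set \<open>C\<close>, at t =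
    1.\<close>
  have S_eq: "S = (\<lambda>x. (\<chi> k. 1 / real N) + (\<Sum>i\<in>J. x i *\<^sub>R b i)) -` C \<inter> space ?PJ"
    using S_iff[of _ 1] by (auto simp: space_PiM S_def)
  have "(\<lambda>x. (\<chi> k. 1 / real N) + (\<Sum>i\<in>J. x i *\<^sub>R b i)) \<in> ?PJ \<rightarrow>\<^sub>M borel"
    by measurable
  then have S: "S \<in> sets ?PJ"
    unfolding S_eq using C by (rule measurable_sets)
  have vol: "vol_E P = measure ?PJ S"
    by (simp add: vol_E_def Let_def S_def J_def N_def b_def)
  have inner: "(\<integral>\<^sup>+x. f (y *\<^sub>R u + (\<Sum>k\<in>J. x k *\<^sub>R b k)) \<partial>?PJ)
      = indicator {0<..} y * ennreal (exp (- (sqrt N * y)) * (sqrt N * y) ^ (N - 1)) * emeasure ?PJ S"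
    if "y \<noteq> 0" for y
  proof -
    have sum_p: "(\<Sum>j\<in>UNIV. (y *\<^sub>R u + (\<Sum>k\<in>J. x k *\<^sub>R b k)) $ j) = sqrt N * y" for x y
    proof -
      have "N * y / sqrt N = sqrt N * y"
        using real_div_sqrt[of N] by (simp add: mult.commute[of _ y] flip: times_divide_eq_right)
      then show ?thesis
        using N by (simp add: sum.distrib sum_comb u_def N_def del: sum_component)
    qed
    show ?thesis
    proof (cases "0 < y")
      case False
      \<comment> \<open>For negative y the coordinate sum sqrt N * y is negative, which
        \<open>pos\<close> excludes; y = 0 is a null set.\<close>
      then have "y *\<^sub>R u + (\<Sum>k\<in>J. x k *\<^sub>R b k) \<notin> C" for x
        using pos[of "y *\<^sub>R u + (\<Sum>k\<in>J. x k *\<^sub>R b k)"] that N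
        by (auto simp: sum_p zero_le_mult_iff simp del: vector_add_component sum_component)
      then show ?thesis
        using False by (simp add: f_def)
    next
      case True
      define t where "t = sqrt N * y"
      have t: "0 < t"
        using True N by (simp add: t_def)
      \<comment> \<open>The slice at height y is centred at t times the barycenter; rescaling the
        frame coordinates by t then turns it into \<open>S\<close> and costs t^(N-1).\<close>
      have yu: "y *\<^sub>R u = t *\<^sub>R (\<chi> k. 1 / real N)"
        using N by (simp add: vec_eq_iff u_def t_def field_simps)
      have "(\<lambda>x. f (y *\<^sub>R u + (\<Sum>k\<in>J. x k *\<^sub>R b k))) \<in> borel_measurable ?PJ"
        by (rule measurable_compose[OF _ f]) measurable
      then have "(\<integral>\<^sup>+x. f (y *\<^sub>R u + (\<Sum>k\<in>J. x k *\<^sub>R b k)) \<partial>?PJ)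
          = ennreal t ^ (N - 1) * (\<integral>\<^sup>+x. f (y *\<^sub>R u + (\<Sum>k\<in>J. (t * x k) *\<^sub>R b k)) \<partial>?PJ)"
      proof (subst nn_integral_PiM_affine[where t="\<lambda>_. t" and c="\<lambda>_. 0"])
        have "(\<Sum>k\<in>J. (\<lambda>k\<in>J. 0 + t * x k) k *\<^sub>R b k) = (\<Sum>k\<in>J. (t * x k) *\<^sub>R b k)" for x
          by (rule sum.cong) auto
        then show "(\<Prod>k\<in>J. ennreal \<bar>t\<bar>)
            * (\<integral>\<^sup>+x. f (y *\<^sub>R u + (\<Sum>k\<in>J. (\<lambda>k\<in>J. 0 + t * x k) k *\<^sub>R b k)) \<partial>?PJ)
          = ennreal t ^ (N - 1) * (\<integral>\<^sup>+x. f (y *\<^sub>R u + (\<Sum>k\<in>J. (t * x k) *\<^sub>R b k)) \<partial>?PJ)"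
          using t by (simp add: J_def)
      qed (use t ins(3) in auto)
      also have "(\<integral>\<^sup>+x. f (y *\<^sub>R u + (\<Sum>k\<in>J. (t * x k) *\<^sub>R b k)) \<partial>?PJ)
          = (\<integral>\<^sup>+x. ennreal (exp (- t)) * indicator S x \<partial>?PJ)"
      proof (rule nn_integral_cong)
        fix x
        assume "x \<in> space ?PJ"
        then have "x \<in> S \<longleftrightarrow> y *\<^sub>R u + (\<Sum>k\<in>J. (t * x k) *\<^sub>R b k) \<in> C"
          using S_iff[OF _ t, of x] by (simp add: space_PiM yu scaleR_add_right scaleR_sum_right)
        moreover have "(\<Sum>j\<in>UNIV. (y *\<^sub>R u + (\<Sum>k\<in>J. (t * x k) *\<^sub>R b k)) $ j) = t"
          unfolding t_def by (rule sum_p)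
        ultimately show "f (y *\<^sub>R u + (\<Sum>k\<in>J. (t * x k) *\<^sub>R b k)) = ennreal (exp (- t)) * indicator S x"
          unfolding f_def by (simp only: indicator_def mult.commute)
      qed
      finally show ?thesis
        using S t True unfolding t_def[symmetric]
        by (simp add: nn_integral_cmult_indicator ennreal_mult ennreal_power mult.assoc[symmetric])
           (simp add: mult.commute)
    qed
  qed
  have "integral\<^sup>N lborel f = (\<integral>\<^sup>+x. f (\<Sum>k<N. x k *\<^sub>R B k) \<partial>Pi\<^sub>M {..<N} (\<lambda>_. lborel))"
    using nn_integral_lborel_basis[OF e f, of B] det by auto
  also have "\<dots> = (\<integral>\<^sup>+y. (\<integral>\<^sup>+x. f (\<Sum>k<N. (x(N - 1 := y)) k *\<^sub>R B k) \<partial>?PJ) \<partial>lborel)"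
    unfolding ins(1)
    by (rule lborel_prod.product_nn_integral_insert_rev[OF ins(3,2)])
       (rule measurable_compose[OF _ f], measurable)
  also have "\<dots> = (\<integral>\<^sup>+y. (\<integral>\<^sup>+x. f (y *\<^sub>R u + (\<Sum>k\<in>J. x k *\<^sub>R b k)) \<partial>?PJ) \<partial>lborel)"
  proof -
    have "(\<Sum>k<N. (x(N - 1 := y)) k *\<^sub>R B k) = y *\<^sub>R u + (\<Sum>k\<in>J. x k *\<^sub>R b k)" for x y
    proof -
      have "(\<Sum>k\<in>J. (x(N - 1 := y)) k *\<^sub>R B k) = (\<Sum>k\<in>J. x k *\<^sub>R b k)"
        by (rule sum.cong) (auto simp: B_def J_def)
      then show ?thesis
        unfolding ins(1) using ins(2,3) by (simp add: B_def)
    qed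
    then show ?thesis
      by (simp only:)
  qed
  also have "\<dots> = (\<integral>\<^sup>+y. indicator {0<..} y * ennreal (exp (- (sqrt N * y)) * (sqrt N * y) ^ (N - 1))
      * emeasure ?PJ S \<partial>lborel)"
  proof (rule nn_integral_cong_AE)
    show "AE y in lborel. (\<integral>\<^sup>+x. f (y *\<^sub>R u + (\<Sum>k\<in>J. x k *\<^sub>R b k)) \<partial>?PJ)
        = indicator {0<..} y * ennreal (exp (- (sqrt N * y)) * (sqrt N * y) ^ (N - 1)) * emeasure ?PJ S"
      using AE_lborel_singleton[of 0] by eventually_elim (rule inner)
  qed
  also have "\<dots> = ennreal (fact (N - 1) / sqrt N) * emeasure ?PJ S"
    using N by (simp add: nn_integral_multc nn_integral_exp_scaled)
  finally have "integral\<^sup>N lborel f = ennreal (fact (N - 1) / sqrt N) * emeasure ?PJ S" .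
  then show ?thesis
    by (simp add: f_def[abs_def] enn2real_mult vol measure_def N_def)
qed

section \<open>The cone of positive semidefinite matrices\<close>

text \<open>A Hermitian matrix is encoded by a real function on index pairs: real parts on and above the
  diagonal, imaginary parts of the upper triangle below it.\<close>

definition hmat :: "(nat \<times> nat \<Rightarrow> real) \<Rightarrow> nat \<Rightarrow> nat \<Rightarrow> complex" where
  "hmat x i j =
     (if i = j then of_real (x (i, i))
      else if i < j then Complex (x (i, j)) (x (j, i))
      else Complex (x (j, i)) (- x (i, j)))"

text \<open>Numbered indices keep all sizes in one type, as induction on the size requires. Only
  coordinates below \<open>n\<close> matter (\<open>psd_cone_cong\<close>), while total functions
  \<open>x\<close> make the cone a closed set of the product topology.\<close>

definition psd_cone :: "nat \<Rightarrow> (nat \<times> nat \<Rightarrow> real) set" where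
  "psd_cone n = {x. \<forall>z. 0 \<le> Re (\<Sum>i<n. \<Sum>j<n. cnj (z i) * hmat x i j * z j)}"

lemma hmat_cong: "x (i, j) = y (i, j) \<Longrightarrow> x (j, i) = y (j, i) \<Longrightarrow> hmat x i j = hmat y i j"
  by (auto simp: hmat_def)

lemma cnj_hmat: "cnj (hmat x i j) = hmat x j i"
  by (auto simp: hmat_def complex_eq_iff)

lemma hmat_diff: "hmat (\<lambda>k. x k - y k) i j = hmat x i j - hmat y i j"
  by (auto simp: hmat_def complex_eq_iff)

lemma psd_cone_cong:
  assumes "\<And>i j. i < n \<Longrightarrow> j < n \<Longrightarrow> x (i, j) = y (i, j)"
  shows "x \<in> psd_cone n \<longleftrightarrow> y \<in> psd_cone n"
proof -
  have "hmat x i j = hmat y i j" if "i < n" "j < n" for i j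
    using assms that by (intro hmat_cong) auto
  then show ?thesis
    by (simp add: psd_cone_def)
qed

lemma closed_psd_cone: "closed (psd_cone n)"
proof -
  have "continuous_on UNIV (\<lambda>x. hmat x i j)" for i j
    unfolding hmat_def Complex_eq
    by (cases "i = j"; cases "i < j")
       (auto intro!: continuous_intros continuous_on_product_coordinates)
  then have "closed {x. 0 \<le> Re (\<Sum>i<n. \<Sum>j<n. cnj (z i) * hmat x i j * z j)}" for z
    by (intro closed_Collect_le continuous_intros) auto
  then show ?thesis
    unfolding psd_cone_def by (rule closed_Collect_all)
qed

text \<open>Points of the product space are \<open>undefined\<close> off \<open>K\<close>, so every
  coordinate is measurable. This transfers Borel facts about total functions, such as closedness of
  \<open>psd_cone\<close>, to every product.\<close>

lemma measurable_PiM_total: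
  fixes K :: "'k::countable set"
  shows "(\<lambda>x. x) \<in> Pi\<^sub>M K (\<lambda>_. lborel :: real measure) \<rightarrow>\<^sub>M (borel :: ('k \<Rightarrow> real) measure)"
proof (rule measurable_coordinatewise_then_product)
  fix k
  show "(\<lambda>x. x k) \<in> borel_measurable (Pi\<^sub>M K (\<lambda>_. lborel :: real measure))"
  proof (cases "k \<in> K")
    case True
    then show ?thesis
      using measurable_component_singleton[OF True, of "\<lambda>_. lborel :: real measure"] by simp
  next
    case False
    then have "x k = undefined" if "x \<in> space (Pi\<^sub>M K (\<lambda>_. lborel :: real measure))" for x
      using that by (auto simp: space_PiM PiE_def extensional_def)
    then show ?thesis
      by (subst measurable_cong[where g="\<lambda>_. undefined"]) auto
  qed
qed

lemma measurable_psd_cone_integrand: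
  "(\<lambda>x. indicator (psd_cone n) x * ennreal (exp (- (\<Sum>i<n. x (i, i)))))
    \<in> borel_measurable (Pi\<^sub>M K (\<lambda>_. lborel))"
proof -
  have [measurable]: "psd_cone n \<in> sets borel"
    by (intro borel_closed closed_psd_cone)
  have "(\<lambda>x. indicator (psd_cone n) x * ennreal (exp (- (\<Sum>i<n. x (i, i))))) \<in> borel_measurable borel"
    by measurable
  then show ?thesis
    using measurable_compose[OF measurable_PiM_total] by blast
qed

lemma psd_cone_diag_nonneg:
  assumes "x \<in> psd_cone n" "k < n"
  shows "0 \<le> x (k, k)"
proof -
  define z :: "nat \<Rightarrow> complex" where "z i = (if i = k then 1 else 0)" for i
  have "(\<Sum>i<n. \<Sum>j<n. cnj (z i) * hmat x i j * z j) = (\<Sum>i<n. if i = k then hmat x i k else 0)"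
    using assms(2) by (intro sum.cong) (auto simp: z_def if_distrib cong: if_cong)
  also have "\<dots> = of_real (x (k, k))"
    using assms(2) by (simp add: hmat_def)
  finally have "(\<Sum>i<n. \<Sum>j<n. cnj (z i) * hmat x i j * z j) = of_real (x (k, k))" .
  moreover have "0 \<le> Re (\<Sum>i<n. \<Sum>j<n. cnj (z i) * hmat x i j * z j)"
    using assms(1) unfolding psd_cone_def by blast
  ultimately show ?thesis
    by (simp only: Re_complex_of_real)
qed

text \<open>For \<open>X = hmat x\<close> with last column \<open>(v, a)\<close>, these are the coordinates of \<open>v v\<^sup>* / a\<close>, so that
  subtracting them gives the Schur complement of the corner entry \<open>a\<close>.\<close>

definition schur_shift :: "nat \<Rightarrow> (nat \<times> nat \<Rightarrow> real) \<Rightarrow> nat \<times> nat \<Rightarrow> real" where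
  "schur_shift n x = (\<lambda>(i, j).
     if i \<le> j then (x (i, n) * x (j, n) + x (n, i) * x (n, j)) / x (n, n)
     else (x (n, j) * x (i, n) - x (j, n) * x (n, i)) / x (n, n))"

lemma hmat_schur_shift:
  assumes "i < n" "j < n"
  shows "hmat (schur_shift n x) i j = hmat x i n * cnj (hmat x j n) / of_real (x (n, n))"
  using assms
  by (auto simp: hmat_def schur_shift_def complex_eq_iff Re_divide_of_real Im_divide_of_real
      minus_divide_left algebra_simps simp del: divide_minus_left)

text \<open>Completing the square in the last coordinate: the large form is the form of the Schur
  complement plus |a * cnj (z n) + S z|^2 / a, and \<open>z n\<close> is free to make the square
  vanish.\<close>

lemma psd_cone_Suc:
  assumes a: "0 < x (n, n)"
  shows "x \<in> psd_cone (Suc n) \<longleftrightarrow> (\<lambda>k. x k - schur_shift n x k) \<in> psd_cone n"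
proof -
  define a where "a = x (n, n)"
  have a0: "0 < a"
    using assms by (simp add: a_def)
  define S where "S z = (\<Sum>i<n. cnj (z i) * hmat x i n)" for z
  define Q where "Q z = (\<Sum>i<n. \<Sum>j<n. cnj (z i) * hmat x i j * z j)" for z
  have cnjS: "cnj (S z) = (\<Sum>j<n. hmat x n j * z j)" for z
    by (simp add: S_def cnj_hmat mult.commute)
  have big: "(\<Sum>i<Suc n. \<Sum>j<Suc n. cnj (z i) * hmat x i j * z j)
      = Q z + S z * z n + cnj (z n) * cnj (S z) + of_real a * (cnj (z n) * z n)" for z
    unfolding cnjS
    by (simp add: Q_def S_def a_def hmat_def[of x n n] sum.distrib sum_distrib_left sum_distrib_right algebra_simps)
  have small: "(\<Sum>i<n. \<Sum>j<n. cnj (z i) * hmat (\<lambda>k. x k - schur_shift n x k) i j * z j)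
      = Q z - S z * cnj (S z) / of_real a" for z
  proof -
    have "(\<Sum>i<n. \<Sum>j<n. cnj (z i) * hmat (\<lambda>k. x k - schur_shift n x k) i j * z j)
        = (\<Sum>i<n. \<Sum>j<n. cnj (z i) * hmat x i j * z j
              - cnj (z i) * hmat x i n * (hmat x n j * z j) / of_real a)"
      by (intro sum.cong refl) (simp add: hmat_diff hmat_schur_shift a_def cnj_hmat algebra_simps)
    also have "\<dots> = Q z - S z * (\<Sum>j<n. hmat x n j * z j) / of_real a"
      by (simp add: Q_def S_def sum_subtractf sum_product sum_divide_distrib)
    also have "\<dots> = Q z - S z * cnj (S z) / of_real a"
      by (simp only: cnjS)
    finally show ?thesis .
  qed
  have square: "Re (S z * z n + cnj (z n) * cnj (S z) + of_real a * (cnj (z n) * z n))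
      = (cmod (of_real a * cnj (z n) + S z))\<^sup>2 / a - Re (S z * cnj (S z) / of_real a)" for z
    using a0 unfolding cmod_power2 by (simp add: Re_divide_of_real field_simps power2_eq_square)
  have eq: "Re (\<Sum>i<Suc n. \<Sum>j<Suc n. cnj (z i) * hmat x i j * z j)
      = Re (\<Sum>i<n. \<Sum>j<n. cnj (z i) * hmat (\<lambda>k. x k - schur_shift n x k) i j * z j)
        + (cmod (of_real a * cnj (z n) + S z))\<^sup>2 / a" for z
    using square[of z] unfolding big small by simp
  show ?thesis
  proof
    assume *: "x \<in> psd_cone (Suc n)"
    show "(\<lambda>k. x k - schur_shift n x k) \<in> psd_cone n"
      unfolding psd_cone_def
    proof (intro CollectI allI)
      fix z :: "nat \<Rightarrow> complex"
      \<comment> \<open>The zero of the square. Neither \<open>S\<close> nor the small form sees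
        coordinate \<open>n\<close>.\<close>
      define z' where "z' = z(n := - cnj (S z) / of_real a)"
      have "S z' = S z"
        by (simp add: S_def z'_def)
      then have "of_real a * cnj (z' n) + S z' = 0"
        using a0 by (simp add: z'_def)
      moreover have "0 \<le> Re (\<Sum>i<Suc n. \<Sum>j<Suc n. cnj (z' i) * hmat x i j * z' j)"
        using * unfolding psd_cone_def by blast
      ultimately have "0 \<le> Re (\<Sum>i<n. \<Sum>j<n. cnj (z' i) * hmat (\<lambda>k. x k - schur_shift n x k) i j * z' j)"
        unfolding eq by simp
      then show "0 \<le> Re (\<Sum>i<n. \<Sum>j<n. cnj (z i) * hmat (\<lambda>k. x k - schur_shift n x k) i j * z j)"
        by (simp add: z'_def)
    qed
  next
    assume "(\<lambda>k. x k - schur_shift n x k) \<in> psd_cone n"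
    then show "x \<in> psd_cone (Suc n)"
      using a0 unfolding psd_cone_def mem_Collect_eq eq by (auto intro!: add_nonneg_nonneg)
  qed
qed

text \<open>The integrand is sqrt (pi * a) times the normal density of variance a / 2.\<close>

lemma nn_integral_gaussian:
  fixes a :: real
  assumes "0 < a"
  shows "(\<integral>\<^sup>+y. ennreal (exp (- (y\<^sup>2 / a))) \<partial>lborel) = ennreal (sqrt (pi * a))"
proof -
  let ?s = "sqrt (a / 2)"
  have s: "0 < ?s"
    using assms by simp
  have eq: "exp (- (y\<^sup>2 / a)) = sqrt (pi * a) * normal_density 0 ?s y" for y
    using assms by (simp add: normal_density_def)
  have "(\<integral>\<^sup>+y. ennreal (normal_density 0 ?s y) \<partial>lborel) = 1"
    using s by (subst nn_integral_eq_integral) (auto simp: integrable_normal_density)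
  then show ?thesis
    using assms unfolding eq by (simp add: ennreal_mult nn_integral_cmult)
qed

lemma nn_integral_psd_cone:
  "(\<integral>\<^sup>+x. indicator (psd_cone n) x * ennreal (exp (- (\<Sum>i<n. x (i, i))))
      \<partial>Pi\<^sub>M ({..<n} \<times> {..<n}) (\<lambda>_. lborel))
    = ennreal (\<Prod>k<n. pi ^ k * fact k)"
proof (induction n)
  case 0
  have "psd_cone 0 = UNIV"
    by (simp add: psd_cone_def)
  then show ?case
    by (simp add: PiM_empty nn_integral_count_space_finite)
next
  case (Suc n)
  define K where "K = {..<n} \<times> {..<n}"
  \<comment> \<open>The last column without its corner: real parts at (i, n), imaginary parts at (n,
    i), hence 2 n real coordinates.\<close>
  define V where "V = (\<lambda>i. (i, n)) ` {..<n} \<union> (\<lambda>i. (n, i)) ` {..<n}"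
  define f where "f x = indicator (psd_cone (Suc n)) x * ennreal (exp (- (\<Sum>i<Suc n. x (i, i))))"
    for x :: "nat \<times> nat \<Rightarrow> real"
  define F where "F = ennreal (\<Prod>k<n. pi ^ k * fact k)"
  let ?P = "\<lambda>I :: (nat \<times> nat) set. Pi\<^sub>M I (\<lambda>_. lborel :: real measure)"
  have fin: "finite K" "finite V" "V \<inter> K = {}" "(n, n) \<notin> V \<union> K"
    by (auto simp: K_def V_def)
  have split: "{..<Suc n} \<times> {..<Suc n} = insert (n, n) (V \<union> K)"
    by (auto simp: K_def V_def less_Suc_eq)
  have sum_V: "(\<Sum>k\<in>V. h k) = (\<Sum>i<n. h (i, n) + h (n, i))" for h :: "nat \<times> nat \<Rightarrow> real"
    unfolding V_def
    by (subst sum.union_disjoint) (auto simp: sum.reindex inj_on_def sum.distrib)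
  have card_V: "card V = 2 * n"
  proof -
    have "real (card V) = real (2 * n)"
      using sum_V[of "\<lambda>_. 1"] by simp
    then show ?thesis
      by (simp only: of_nat_eq_iff)
  qed
  have f_meas: "f \<in> borel_measurable (?P I)" for I
    unfolding f_def by (rule measurable_psd_cone_integrand)
  have inner: "(\<integral>\<^sup>+y. f ((merge V K (v, y))((n, n) := a)) \<partial>?P K)
      = F * (ennreal (exp (- a)) * (\<Prod>k\<in>V. ennreal (exp (- ((v k)\<^sup>2 / a)))))"
    if a: "0 < a" and v: "v \<in> space (?P V)" for a v
  proof -
    define x where "x y = (merge V K (v, y))((n, n) := a)" for y
    \<comment> \<open>The shift depends on the last column alone, so it may be computed with a zero
      block. For fixed \<open>v\<close> and \<open>a\<close> the passage to the Schur complement is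
      thus a translation of \<open>y\<close>.\<close>
    define c where "c = schur_shift n (x (\<lambda>_. 0))"
    have x_V: "x y (i, n) = v (i, n)" "x y (n, i) = v (n, i)" if "i < n" for y i
      using that by (auto simp: x_def merge_def V_def)
    have x_a: "x y (n, n) = a" for y
      by (simp add: x_def)
    have x_K: "x y (i, j) = y (i, j)" if "i < n" "j < n" for y i j
      using that by (auto simp: x_def merge_def V_def K_def)
    have c: "schur_shift n (x y) (i, j) = c (i, j)" if "i < n" "j < n" for y i j
      using that by (simp add: c_def schur_shift_def x_V x_a)
    \<comment> \<open>The trace of the shift is the squared norm of the column divided by
      \<open>a\<close>. Translating the block moves it into the exponent, where it is the Gaussian
      weight of the column.\<close>
    have "(\<Sum>i<n. c (i, i)) = (\<Sum>k\<in>V. (v k)\<^sup>2 / a)"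
      unfolding sum_V by (rule sum.cong)
        (auto simp: c_def schur_shift_def x_V x_a power2_eq_square add_divide_distrib)
    then have exp_c: "ennreal (exp (- (\<Sum>i<n. c (i, i)))) = (\<Prod>k\<in>V. ennreal (exp (- ((v k)\<^sup>2 / a))))"
      using fin(2) by (simp add: prod_ennreal exp_sum sum_negf[symmetric])
    have fx: "f (x (\<lambda>k\<in>K. c k + 1 * y k)) = indicator (psd_cone n) y * ennreal (exp (- (\<Sum>i<n. y (i, i))))
        * (ennreal (exp (- a)) * (\<Prod>k\<in>V. ennreal (exp (- ((v k)\<^sup>2 / a)))))" for y
    proof -
      let ?y = "\<lambda>k\<in>K. c k + 1 * y k"
      have y: "?y (i, j) = c (i, j) + y (i, j)" if "i < n" "j < n" for i j
        using that by (simp add: K_def)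
      have "x ?y \<in> psd_cone (Suc n) \<longleftrightarrow> (\<lambda>k. x ?y k - schur_shift n (x ?y) k) \<in> psd_cone n"
        using a by (intro psd_cone_Suc) (simp add: x_a)
      moreover have "(\<lambda>k. x ?y k - schur_shift n (x ?y) k) \<in> psd_cone n \<longleftrightarrow> y \<in> psd_cone n"
      proof (rule psd_cone_cong)
        fix i j
        assume ij: "i < n" "j < n"
        show "x ?y (i, j) - schur_shift n (x ?y) (i, j) = y (i, j)"
          unfolding x_K[OF ij] c[OF ij] y[OF ij] by (rule add_diff_cancel_left')
      qed
      ultimately have "indicator (psd_cone (Suc n)) (x ?y) = (indicator (psd_cone n) y :: ennreal)"
        unfolding indicator_def by (simp only:)
      moreover have "(\<Sum>i<Suc n. x ?y (i, i)) = (\<Sum>i<n. c (i, i)) + (\<Sum>i<n. y (i, i)) + a"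
      proof -
        have "(\<Sum>i<n. x ?y (i, i)) = (\<Sum>i<n. c (i, i) + y (i, i))"
          by (intro sum.cong refl) (simp only: lessThan_iff x_K y)
        then show ?thesis
          by (simp only: sum.lessThan_Suc x_a sum.distrib)
      qed
      moreover have "exp (- (s + t + a)) = exp (- t) * (exp (- a) * exp (- s))" for s t :: real
      proof -
        have "- (s + t + a) = - t + (- a + - s)"
          by simp
        then show ?thesis
          by (simp only: exp_add)
      qed
      ultimately show ?thesis
        unfolding f_def exp_c[symmetric] by (simp add: ennreal_mult mult.assoc)
    qed
    have x_meas: "(\<lambda>y. f (x y)) \<in> borel_measurable (?P K)"
    proof -
      have "(\<lambda>y. merge V K (v, y)) \<in> ?P K \<rightarrow>\<^sub>M ?P (V \<union> K)"
        using v by measurable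
      then have "x \<in> ?P K \<rightarrow>\<^sub>M ?P (insert (n, n) (V \<union> K))"
        unfolding x_def by (intro measurable_fun_upd[where J="V \<union> K"]) auto
      then show ?thesis
        using f_meas by (rule measurable_compose)
    qed
    have "(\<integral>\<^sup>+y. f (x y) \<partial>?P K) = (\<integral>\<^sup>+y. f (x (\<lambda>k\<in>K. c k + 1 * y k)) \<partial>?P K)"
      using nn_integral_PiM_affine[OF fin(1) _ x_meas, of "\<lambda>_. 1" c] by simp
    also have "\<dots> = F * (ennreal (exp (- a)) * (\<Prod>k\<in>V. ennreal (exp (- ((v k)\<^sup>2 / a)))))"
      unfolding fx using measurable_psd_cone_integrand[of n K] Suc.IH
      by (simp add: nn_integral_multc F_def K_def)
    finally show ?thesis
      by (simp only: x_def)
  qed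
  have outer: "(\<integral>\<^sup>+x. f (x((n, n) := a)) \<partial>?P (V \<union> K))
      = F * ennreal (pi ^ n) * (indicator {0<..} a * ennreal (exp (- (1 * a)) * (1 * a) ^ n))"
    if "a \<noteq> 0" for a
  proof (cases "0 < a")
    case False
    \<comment> \<open>A negative corner is a negative diagonal entry; a = 0 is a null set.\<close>
    then have "x((n, n) := a) \<notin> psd_cone (Suc n)" for x
      using psd_cone_diag_nonneg[of "x((n, n) := a)" "Suc n" n] that by auto
    then show ?thesis
      using False by (simp add: f_def)
  next
    case True
    have "(\<lambda>x. x((n, n) := a)) \<in> ?P (V \<union> K) \<rightarrow>\<^sub>M ?P (insert (n, n) (V \<union> K))"
      by (intro measurable_fun_upd[where J="V \<union> K"]) auto
    then have "(\<lambda>x. f (x((n, n) := a))) \<in> borel_measurable (?P (V \<union> K))"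
      using f_meas by (rule measurable_compose)
    then have "(\<integral>\<^sup>+x. f (x((n, n) := a)) \<partial>?P (V \<union> K))
        = (\<integral>\<^sup>+v. \<integral>\<^sup>+y. f ((merge V K (v, y))((n, n) := a)) \<partial>?P K \<partial>?P V)"
      using fin by (intro lborel_prod.product_nn_integral_fold) auto
    also have "\<dots> = (\<integral>\<^sup>+v. F * (ennreal (exp (- a)) * (\<Prod>k\<in>V. ennreal (exp (- ((v k)\<^sup>2 / a))))) \<partial>?P V)"
      using True by (intro nn_integral_cong inner)
    also have "\<dots> = F * (ennreal (exp (- a)) * (\<integral>\<^sup>+v. (\<Prod>k\<in>V. ennreal (exp (- ((v k)\<^sup>2 / a)))) \<partial>?P V))"
    proof -
      have "(\<lambda>v. \<Prod>k\<in>V. ennreal (exp (- ((v k)\<^sup>2 / a)))) \<in> borel_measurable (?P V)"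
        by measurable
      then show ?thesis
        by (simp add: nn_integral_cmult)
    qed
    also have "(\<integral>\<^sup>+v. (\<Prod>k\<in>V. ennreal (exp (- ((v k)\<^sup>2 / a)))) \<partial>?P V) = ennreal (sqrt (pi * a)) ^ (2 * n)"
      using fin(2) True
      by (subst lborel_prod.product_nn_integral_prod) (auto simp: nn_integral_gaussian card_V)
    also have "\<dots> = ennreal (pi ^ n) * ennreal (a ^ n)"
      using True by (simp add: power_mult ennreal_power power_mult_distrib ennreal_mult[symmetric])
    also have "F * (ennreal (exp (- a)) * (ennreal (pi ^ n) * ennreal (a ^ n)))
        = F * ennreal (pi ^ n) * (indicator {0<..} a * ennreal (exp (- (1 * a)) * (1 * a) ^ n))"
      using True by (simp add: ennreal_mult mult_ac)
    finally show ?thesis .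
  qed
  have "(\<integral>\<^sup>+x. f x \<partial>?P ({..<Suc n} \<times> {..<Suc n})) = (\<integral>\<^sup>+a. \<integral>\<^sup>+x. f (x((n, n) := a)) \<partial>?P (V \<union> K) \<partial>lborel)"
    unfolding split
    by (rule lborel_prod.product_nn_integral_insert_rev[OF _ fin(4) f_meas]) (simp add: fin(1,2))
  also have "\<dots> = (\<integral>\<^sup>+a. F * ennreal (pi ^ n) * (indicator {0<..} a * ennreal (exp (- (1 * a)) * (1 * a) ^ n)) \<partial>lborel)"
  proof (rule nn_integral_cong_AE)
    show "AE a in lborel. (\<integral>\<^sup>+x. f (x((n, n) := a)) \<partial>?P (V \<union> K))
        = F * ennreal (pi ^ n) * (indicator {0<..} a * ennreal (exp (- (1 * a)) * (1 * a) ^ n))"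
      using AE_lborel_singleton[of 0] by eventually_elim (rule outer)
  qed
  also have "\<dots> = F * ennreal (pi ^ n) * ennreal (fact n / 1)"
  proof -
    have "(\<lambda>a :: real. indicator {0<..} a * ennreal (exp (- (1 * a)) * (1 * a) ^ n)) \<in> borel_measurable lborel"
      by measurable
    then show ?thesis
      by (simp only: nn_integral_cmult nn_integral_exp_scaled[OF zero_less_one])
  qed
  also have "\<dots> = ennreal (\<Prod>k<Suc n. pi ^ k * fact k)"
    unfolding F_def by (simp add: ennreal_mult prod_nonneg mult.assoc)
  finally show ?case
    by (simp only: f_def)
qed

section \<open>Determinants of positive definite matrices\<close>

text \<open>A maximizer of x . f x on the unit sphere of \<open>S\<close> is an eigenvector, and its
  orthogonal complement in \<open>S\<close> is again invariant because \<open>f\<close> is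
  self-adjoint.\<close>

lemma selfadjoint_orthonormal_eigenbasis:
  fixes f :: "'a::euclidean_space \<Rightarrow> 'a"
  assumes f: "linear f" and adj: "\<And>x y. f x \<bullet> y = x \<bullet> f y"
  shows "subspace S \<Longrightarrow> f ` S \<subseteq> S \<Longrightarrow>
    \<exists>B. finite B \<and> card B = dim S \<and> B \<subseteq> S \<and> pairwise orthogonal B
      \<and> (\<forall>b\<in>B. norm b = 1 \<and> (\<exists>c. f b = c *\<^sub>R b))"
proof (induction "dim S" arbitrary: S)
  case 0
  then show ?case
    by (intro exI[of _ "{}"]) auto
next
  case (Suc n)
  note S = \<open>subspace S\<close> and fS = \<open>f ` S \<subseteq> S\<close>
  have cont_f: "continuous_on A f" for A
    using f by (simp add: linear_continuous_on linear_linear)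
  have "S \<noteq> {0}"
    using Suc.hyps(2) by auto
  then obtain s where s: "s \<in> S" "s \<noteq> 0"
    using S subspace_0 by blast
  have "compact (S \<inter> sphere 0 1)"
    using S by (intro closed_Int_compact closed_subspace compact_sphere)
  moreover have "s /\<^sub>R norm s \<in> S \<inter> sphere 0 1"
    using s S by (auto simp: subspace_mul)
  then have "S \<inter> sphere 0 1 \<noteq> {}"
    by blast
  moreover have "continuous_on (S \<inter> sphere 0 1) (\<lambda>x. x \<bullet> f x)"
    by (intro continuous_intros cont_f)
  ultimately obtain v where v: "v \<in> S" "norm v = 1"
    and v_max: "\<And>x. x \<in> S \<Longrightarrow> norm x = 1 \<Longrightarrow> x \<bullet> f x \<le> v \<bullet> f v"
    using continuous_attains_sup[of "S \<inter> sphere 0 1" "\<lambda>x. x \<bullet> f x"] by (metis IntE IntI dist_0_norm mem_sphere)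
  define c where "c = v \<bullet> f v"
  \<comment> \<open>By maximality \<open>g\<close> is a nonnegative quadratic form on
    \<open>S\<close>, and it vanishes at \<open>v\<close>. Its first variation at \<open>v\<close>
    must therefore vanish too, which is \<open>ortho\<close>.\<close>
  define g where "g x = c * (x \<bullet> x) - x \<bullet> f x" for x
  have g_nonneg: "0 \<le> g x" if "x \<in> S" for x
  proof (cases "x = 0")
    case False
    define y where "y = x /\<^sub>R norm x"
    have "y \<in> S" "norm y = 1"
      using that False S by (auto simp: y_def subspace_mul)
    then have "y \<bullet> f y \<le> c"
      unfolding c_def by (rule v_max)
    moreover have x: "x = norm x *\<^sub>R y"
      using False by (simp add: y_def)
    have "x \<bullet> f x = (norm x)\<^sup>2 * (y \<bullet> f y)"
      by (subst (1 2) x) (simp add: linear_cmul[OF f] power2_eq_square)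
    ultimately show ?thesis
      by (simp add: g_def dot_square_norm mult_left_mono mult.commute[of c])
  qed (simp add: g_def)
  have ortho: "(c *\<^sub>R v - f v) \<bullet> w = 0" if w: "w \<in> S" for w
  proof -
    let ?\<beta> = "(c *\<^sub>R v - f v) \<bullet> w"
    define \<gamma> where "\<gamma> = g w"
    \<comment> \<open>Near the minimizer - \<beta> / \<gamma> of 2 t \<beta> + t^2 \<gamma>, with 1
      added so that \<gamma> = 0 is covered. The value is negative unless \<beta> = 0.\<close>
    define t where "t = - ?\<beta> / (\<gamma> + 1)"
    have \<gamma>: "0 \<le> \<gamma>"
      unfolding \<gamma>_def by (rule g_nonneg[OF w])
    have "v \<bullet> v = 1"
      using v(2) by (simp add: dot_square_norm)
    then have "(v + t *\<^sub>R w) \<bullet> (v + t *\<^sub>R w) = 1 + 2 * t * (v \<bullet> w) + t\<^sup>2 * (w \<bullet> w)"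
      by (simp add: inner_add_left inner_add_right inner_commute[of w v] power2_eq_square distrib_left)
    moreover have "v \<bullet> f w = f v \<bullet> w" "w \<bullet> f v = f v \<bullet> w"
      using adj[of v w] inner_commute[of w "f v"] by simp_all
    then have "(v + t *\<^sub>R w) \<bullet> f (v + t *\<^sub>R w) = c + 2 * t * (f v \<bullet> w) + t\<^sup>2 * (w \<bullet> f w)"
      by (simp add: linear_add[OF f] linear_cmul[OF f] inner_add_left inner_add_right c_def power2_eq_square distrib_left)
    ultimately have "g (v + t *\<^sub>R w) = 2 * t * ?\<beta> + t\<^sup>2 * \<gamma>"
      by (simp only: g_def \<gamma>_def inner_diff_left inner_scaleR_left) (simp add: algebra_simps)
    also have "\<dots> = - ?\<beta>\<^sup>2 * (\<gamma> + 2) / (\<gamma> + 1)\<^sup>2"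
      using \<gamma> by (simp add: t_def power_divide divide_simps) (simp add: power2_eq_square algebra_simps)
    finally have "g (v + t *\<^sub>R w) = - ?\<beta>\<^sup>2 * (\<gamma> + 2) / (\<gamma> + 1)\<^sup>2" .
    moreover have "0 \<le> g (v + t *\<^sub>R w)"
      using S v w by (intro g_nonneg subspace_add subspace_mul)
    ultimately have "?\<beta>\<^sup>2 * (\<gamma> + 2) / (\<gamma> + 1)\<^sup>2 \<le> 0"
      by simp
    moreover have "0 < (\<gamma> + 2) / (\<gamma> + 1)\<^sup>2"
      using \<gamma> by simp
    ultimately have "?\<beta>\<^sup>2 \<le> 0"
      by (metis mult_pos_pos not_le times_divide_eq_right)
    then show ?thesis
      by simp
  qed
  have "c *\<^sub>R v - f v \<in> S"
    using S fS v(1) by (auto intro!: subspace_diff subspace_mul)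
  then have "(c *\<^sub>R v - f v) \<bullet> (c *\<^sub>R v - f v) = 0"
    by (rule ortho)
  then have fv: "f v = c *\<^sub>R v"
    by simp
  define S' where "S' = {y \<in> S. \<forall>x\<in>span {v}. orthogonal x y}"
  have v_orth: "y \<bullet> v = 0" if "y \<in> S'" for y
    using that by (auto simp: S'_def orthogonal_def span_base inner_commute)
  have S'_iff: "y \<in> S' \<longleftrightarrow> y \<in> S \<and> v \<bullet> y = 0" for y
    by (auto simp: S'_def orthogonal_def span_singleton)
  have S': "subspace S'"
    using S by (auto simp: subspace_def S'_iff inner_add_right)
  have "f ` S' \<subseteq> S'"
  proof (rule image_subsetI)
    fix y
    assume "y \<in> S'"
    then show "f y \<in> S'"
      using fS adj[of v y, symmetric] by (auto simp: S'_iff fv)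
  qed
  moreover have "dim S' + dim (span {v}) = dim S"
    unfolding S'_def using S v(1)
    by (intro dim_subspace_orthogonal_to_vectors) (auto intro: span_minimal[THEN subsetD])
  moreover have "v \<noteq> 0"
    using v(2) by auto
  then have "dim (span {v}) = 1"
    by (simp add: dim_singleton)
  ultimately have "n = dim S'" "f ` S' \<subseteq> S'" "dim S = Suc (dim S')"
    using Suc.hyps(2) by auto
  then obtain B where B: "finite B" "card B = dim S'" "B \<subseteq> S'" "pairwise orthogonal B"
    "\<And>b. b \<in> B \<Longrightarrow> norm b = 1 \<and> (\<exists>c. f b = c *\<^sub>R b)"
    using Suc.hyps(1)[OF _ S'] by metis
  have "v \<notin> B"
    using B(3) v_orth[of v] v(2) by (auto simp: dot_square_norm)
  moreover have "pairwise orthogonal (insert v B)"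
    using B(3,4) v_orth by (auto simp: pairwise_insert orthogonal_def inner_commute)
  ultimately show ?case
    using B v fv \<open>dim S = Suc (dim S')\<close> by (intro exI[of _ "insert v B"]) (auto simp: S'_iff)
qed

lemma symmetric_matrix_diagonalization:
  fixes A :: "real^'m^'m"
  assumes A: "transpose A = A"
  obtains P l where "orthogonal_matrix P" "A = P ** (\<chi> i j. if i = j then l i else 0) ** transpose P"
    "\<And>i. A *v column i P = l i *\<^sub>R column i P"
proof -
  have "(A *v x) \<bullet> y = x \<bullet> (A *v y)" for x y
    using dot_lmul_matrix[of x A y] by (metis A transpose_matrix_vector)
  then obtain B where B: "finite B" "card B = CARD('m)" "pairwise orthogonal B"
    "\<And>b. b \<in> B \<Longrightarrow> norm b = 1 \<and> (\<exists>c. A *v b = c *\<^sub>R b)"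
    using selfadjoint_orthonormal_eigenbasis[of "(*v) A" UNIV] by auto
  then obtain e where e: "bij_betw e (UNIV :: 'm set) B"
    using finite_same_card_bij[of "UNIV :: 'm set" B] by auto
  have eB: "e i \<in> B" for i
    using e by (auto simp: bij_betw_def)
  obtain l where l: "\<And>i. A *v e i = l i *\<^sub>R e i"
    using B(4)[OF eB] by metis
  have orth: "e i \<bullet> e j = (if i = j then 1 else 0)" for i j
  proof (cases "i = j")
    case True
    then show ?thesis
      using B(4)[OF eB] by (simp add: dot_square_norm)
  next
    case False
    then have "e i \<noteq> e j"
      using e by (auto simp: bij_betw_def inj_def)
    then show ?thesis
      using pairwiseD[OF B(3) eB eB] False by (simp add: orthogonal_def)
  qed
  define P where "P = (\<chi> i j. e j $ i)"
  have col: "column i P = e i" for i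
    by (simp add: P_def column_def)
  have "transpose P ** P = mat 1"
    using orth by (simp add: P_def matrix_matrix_mult_def transpose_def mat_def vec_eq_iff inner_vec_def)
  then have P: "orthogonal_matrix P"
    by (simp add: orthogonal_matrix)
  have "A ** P = P ** (\<chi> i j. if i = j then l i else 0)"
  proof -
    have "(A ** P) $ i $ j = (A *v e j) $ i" for i j
      by (simp add: P_def matrix_matrix_mult_def matrix_vector_mult_def)
    then show ?thesis
      by (simp add: vec_eq_iff l) (simp add: P_def matrix_matrix_mult_def if_distrib cong: if_cong)
  qed
  then have "A ** (P ** transpose P) = P ** (\<chi> i j. if i = j then l i else 0) ** transpose P"
    by (simp add: matrix_mul_assoc)
  then have eq: "A = P ** (\<chi> i j. if i = j then l i else 0) ** transpose P"
    using P by (simp add: orthogonal_matrix_def)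
  show thesis
    by (rule that[OF P eq]) (simp add: col l)
qed

text \<open>The inequality of arithmetic and geometric means with its equality case, normalized to
  mean at most 1. Both parts come from ln x \<le> x - 1, with equality only at x = 1.\<close>

lemma prod_le_one_if_sum_le_card:
  fixes x :: "'i \<Rightarrow> real"
  assumes I: "finite I" and pos: "\<And>i. i \<in> I \<Longrightarrow> 0 < x i" and sum: "(\<Sum>i\<in>I. x i) \<le> card I"
  shows "(\<Prod>i\<in>I. x i) \<le> 1" "(\<Prod>i\<in>I. x i) = 1 \<Longrightarrow> i \<in> I \<Longrightarrow> x i = 1"
proof -
  have ln: "ln (\<Prod>i\<in>I. x i) = (\<Sum>i\<in>I. ln (x i))"
    using I pos by (intro ln_prod) (auto simp: less_imp_neq[THEN not_sym])
  have le: "ln (x i) \<le> x i - 1" if "i \<in> I" for i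
    using pos[OF that] by (rule ln_le_minus_one)
  have sum': "(\<Sum>i\<in>I. x i - 1) \<le> 0"
    using sum by (simp add: sum_subtractf)
  have "(\<Sum>i\<in>I. ln (x i)) \<le> (\<Sum>i\<in>I. x i - 1)"
    by (intro sum_mono le)
  then have "ln (\<Prod>i\<in>I. x i) \<le> 0"
    using ln sum' by simp
  moreover have "0 < (\<Prod>i\<in>I. x i)"
    by (intro prod_pos) (auto simp: pos)
  ultimately show "(\<Prod>i\<in>I. x i) \<le> 1"
    using ln_le_zero_iff by blast
  show "x i = 1" if "(\<Prod>i\<in>I. x i) = 1" "i \<in> I"
  proof -
    have "(\<Sum>i\<in>I. (x i - 1) - ln (x i)) \<le> 0"
      using ln sum' that(1) by (simp add: sum_subtractf)
    moreover have "0 \<le> (\<Sum>i\<in>I. (x i - 1) - ln (x i))"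
      using le by (intro sum_nonneg) simp
    ultimately have "(\<Sum>i\<in>I. (x i - 1) - ln (x i)) = 0"
      by (rule antisym)
    then have "(x i - 1) - ln (x i) = 0"
      using I that(2) le by (subst (asm) sum_nonneg_eq_0_iff) auto
    then show ?thesis
      using pos[OF that(2)] by (intro ln_eq_minus_one) auto
  qed
qed

text \<open>Determinant and trace are the product and the sum of the positive eigenvalues, so the
  mean inequality applies. If all eigenvalues are 1, the diagonalization collapses to the
  identity.\<close>

lemma det_pos_def:
  fixes A :: "real^'m^'m"
  assumes A: "transpose A = A" and pos: "\<And>x. x \<noteq> 0 \<Longrightarrow> 0 < x \<bullet> (A *v x)"
  shows det_pos_def_pos: "0 < det A"
    and det_pos_def_le_one: "trace A \<le> CARD('m) \<Longrightarrow> det A \<le> 1"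
    and det_pos_def_eq_one: "trace A \<le> CARD('m) \<Longrightarrow> det A = 1 \<Longrightarrow> A = mat 1"
proof -
  obtain P l where P: "orthogonal_matrix P" and eq: "A = P ** (\<chi> i j. if i = j then l i else 0) ** transpose P"
    and eig: "\<And>i. A *v column i P = l i *\<^sub>R column i P"
    using symmetric_matrix_diagonalization[OF A] by blast
  let ?D = "\<chi> i j. if i = j then l i else 0"
  have norm_col: "norm (column i P) = 1" for i
    using P by (simp add: orthogonal_matrix_orthonormal_columns)
  have l: "0 < l i" for i
  proof -
    have "column i P \<noteq> 0"
      using norm_col[of i] by auto
    then have "0 < column i P \<bullet> (A *v column i P)"
      by (rule pos)
    then show ?thesis
      by (simp add: eig dot_square_norm norm_col)
  qed
  have "det P * det (transpose P) = 1"
    using P by (metis det_I det_mul orthogonal_matrix_def)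
  then have "det A = det ?D"
    unfolding eq by (simp add: det_mul)
  then have det: "det A = (\<Prod>i\<in>UNIV. l i)"
    by (simp add: det_diagonal)
  then show "0 < det A"
    using l by (simp add: prod_pos)
  have "trace A = trace (transpose P ** (P ** ?D))"
    unfolding eq by (rule trace_mul_sym)
  then have tr: "trace A = (\<Sum>i\<in>UNIV. l i)"
    using P by (simp add: matrix_mul_assoc orthogonal_matrix_def trace_def)
  show "det A \<le> 1" if "trace A \<le> CARD('m)"
    unfolding det using l that tr by (intro prod_le_one_if_sum_le_card) auto
  show "A = mat 1" if "trace A \<le> CARD('m)" "det A = 1"
  proof -
    have "l i = 1" for i
      using prod_le_one_if_sum_le_card(2)[of UNIV l i] l that tr det by simp
    then have "?D = mat 1"
      by (simp add: mat_def vec_eq_iff)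
    then show ?thesis
      using P unfolding eq by (simp add: orthogonal_matrix_def)
  qed
qed

text \<open>An orthogonal map taking a multiple \<open>a\<close> of a coordinate axis to
  \<open>v\<close> conjugates the matrix to a diagonal one, with a single entry different from
  1.\<close>

lemma det_rank_one_update:
  fixes v :: "real^'m"
  shows "det (\<chi> i j. (if i = j then 1 else 0) - c * (v $ i * v $ j)) = 1 - c * (v \<bullet> v)"
proof -
  obtain k :: 'm where True
    by simp
  define a :: "real^'m" where "a = norm v *\<^sub>R axis k 1"
  obtain f where f: "orthogonal_transformation f" "f a = v"
  proof (rule orthogonal_transformation_exists[of a v])
    show "norm a = norm v"
      by (simp add: a_def norm_axis_1)
  qed
  define Q where "Q = matrix f"
  have Q: "orthogonal_matrix Q" and Qa: "Q *v a = v"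
    using f by (simp_all add: Q_def orthogonal_transformation_matrix matrix_works)
  define M where "M u = (\<chi> i j. (if i = j then 1 else 0) - c * (u $ i * u $ j))" for u :: "real^'m"
  have M: "M (Q *v a) = Q ** M a ** transpose Q"
  proof -
    have "(Q ** M a ** transpose Q) $ i $ j
        = (\<Sum>p\<in>UNIV. Q $ i $ p * Q $ j $ p) - c * ((Q *v a) $ i * (Q *v a) $ j)" for i j
    proof -
      have "(Q ** M a ** transpose Q) $ i $ j
          = (\<Sum>q\<in>UNIV. (\<Sum>p\<in>UNIV. Q $ i $ p * ((if p = q then 1 else 0) - c * (a $ p * a $ q))) * Q $ j $ q)"
        by (simp add: M_def matrix_matrix_mult_def transpose_def)
      also have "\<dots> = (\<Sum>q\<in>UNIV. (Q $ i $ q - c * (Q *v a) $ i * a $ q) * Q $ j $ q)"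
      proof (intro sum.cong refl arg_cong2[where f="(*)"])
        fix q
        have "Q $ i $ p * ((if p = q then 1 else 0) - c * (a $ p * a $ q))
            = (if p = q then Q $ i $ q else 0) - c * a $ q * (Q $ i $ p * a $ p)" for p
          by (simp add: algebra_simps)
        then show "(\<Sum>p\<in>UNIV. Q $ i $ p * ((if p = q then 1 else 0) - c * (a $ p * a $ q)))
            = Q $ i $ q - c * (Q *v a) $ i * a $ q"
          by (simp add: sum_subtractf matrix_vector_mult_def sum_distrib_left mult_ac)
      qed
      also have "\<dots> = (\<Sum>p\<in>UNIV. Q $ i $ p * Q $ j $ p) - c * ((Q *v a) $ i * (Q *v a) $ j)"
      proof -
        have "(\<Sum>q\<in>UNIV. (Q $ i $ q - c * r * a $ q) * Q $ j $ q)
            = (\<Sum>p\<in>UNIV. Q $ i $ p * Q $ j $ p) - c * (r * (\<Sum>q\<in>UNIV. Q $ j $ q * a $ q))" for r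
          by (simp add: sum_subtractf sum_distrib_left algebra_simps)
        moreover have "(Q *v a) $ j = (\<Sum>q\<in>UNIV. Q $ j $ q * a $ q)"
          by (simp add: matrix_vector_mult_def)
        ultimately show ?thesis
          by (simp only:)
      qed
      finally show ?thesis .
    qed
    moreover have "(\<Sum>p\<in>UNIV. Q $ i $ p * Q $ j $ p) = (if i = j then 1 else 0)" for i j
    proof -
      have "(Q ** transpose Q) $ i $ j = mat 1 $ i $ j"
        using Q by (simp add: orthogonal_matrix_def)
      then show ?thesis
        by (simp add: matrix_matrix_mult_def transpose_def mat_def)
    qed
    ultimately show ?thesis
      by (simp add: vec_eq_iff M_def)
  qed
  have "det Q * det (transpose Q) = 1"
    using Q by (metis det_I det_mul orthogonal_matrix_def)
  then have "det (M v) = det (M a)"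
    using M by (simp add: Qa det_mul)
  also have "\<dots> = (\<Prod>i\<in>UNIV. M a $ i $ i)"
    by (rule det_diagonal) (auto simp: M_def a_def axis_def)
  also have "\<dots> = (\<Prod>i\<in>UNIV. if i = k then 1 - c * (v \<bullet> v) else 1)"
    by (rule prod.cong) (auto simp: M_def a_def axis_def dot_square_norm power2_eq_square)
  also have "\<dots> = 1 - c * (v \<bullet> v)"
    by simp
  finally show ?thesis
    by (simp add: M_def)
qed

section \<open>The Gram matrix of a MIC\<close>

definition sesq :: "complex^'n^'n \<Rightarrow> complex^'n \<Rightarrow> complex^'n \<Rightarrow> complex" where
  "sesq X u v = (\<Sum>i\<in>UNIV. cnj (u $ i) * (X *v v) $ i)"

lemma hermitian_cnj: "hermitian X \<Longrightarrow> cnj (X $ i $ j) = X $ j $ i"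
  by (metis (mono_tags, lifting) conj_transpose_def hermitian_def vec_lambda_beta)

lemma sesq_add: "sesq X (u + u') v = sesq X u v + sesq X u' v" "sesq X u (v + v') = sesq X u v + sesq X u v'"
  by (simp_all add: sesq_def matrix_vector_right_distrib distrib_left distrib_right sum.distrib)

lemma sesq_scale: "sesq X (c *s u) v = cnj c * sesq X u v" "sesq X u (c *s v) = c * sesq X u v"
  by (simp_all add: sesq_def vector_scalar_commute sum_distrib_left mult_ac)

lemma sesq_combination:
  "sesq X (a *s u + b *s v) (a *s u + b *s v)
    = cnj a * a * sesq X u u + cnj a * b * sesq X u v + cnj b * a * sesq X v u + cnj b * b * sesq X v v"
  by (simp add: sesq_add sesq_scale algebra_simps)

lemma sesq_axis: "sesq X (axis i 1) (axis j 1) = X $ i $ j"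
proof -
  have "sesq X (axis i 1) (axis j 1) = (\<Sum>k\<in>UNIV. if k = i then (X *v axis j 1) $ i else 0)"
    unfolding sesq_def by (rule sum.cong) (auto simp: axis_def)
  also have "\<dots> = (\<Sum>k\<in>UNIV. if k = j then X $ i $ j else 0)"
    by (simp add: matrix_vector_mult_def axis_def if_distrib cong: if_cong)
  finally show ?thesis
    by simp
qed

lemma cnj_sesq:
  assumes "hermitian X"
  shows "cnj (sesq X u v) = sesq X v u"
proof -
  have "cnj (sesq X u v) = (\<Sum>i\<in>UNIV. \<Sum>j\<in>UNIV. u $ i * (cnj (v $ j) * cnj (X $ i $ j)))"
    by (simp add: sesq_def matrix_vector_mult_def sum_distrib_left mult_ac)
  also have "\<dots> = (\<Sum>j\<in>UNIV. \<Sum>i\<in>UNIV. u $ i * (cnj (v $ j) * cnj (X $ i $ j)))"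
    by (rule sum.swap)
  also have "\<dots> = sesq X v u"
    by (simp add: sesq_def matrix_vector_mult_def sum_distrib_left hermitian_cnj[OF assms] mult_ac)
  finally show ?thesis .
qed

lemma pos_semidef_iff: "pos_semidef X \<longleftrightarrow> hermitian X \<and> (\<forall>v. 0 \<le> Re (sesq X v v))"
  by (simp add: pos_semidef_def sesq_def)

text \<open>Positivity at v - r z u for real r, with z = \<open>sesq X u v\<close>, gives a
  quadratic inequality in r. The choice r = 1 / a yields the claim; a may vanish only together with
  z.\<close>

lemma pos_semidef_Cauchy_Schwarz:
  assumes X: "pos_semidef X"
  shows "(cmod (sesq X u v))\<^sup>2 \<le> Re (sesq X u u) * Re (sesq X v v)"
proof -
  define z where "z = sesq X u v"
  define a where "a = Re (sesq X u u)"
  define b where "b = Re (sesq X v v)"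
  have herm: "hermitian X" and pos: "\<And>v. 0 \<le> Re (sesq X v v)"
    using X by (auto simp: pos_semidef_iff)
  have zc: "sesq X v u = cnj z"
    using cnj_sesq[OF herm, of u v] by (simp add: z_def)
  have aa: "sesq X u u = of_real a"
    using cnj_sesq[OF herm, of u u] by (simp add: a_def complex_eq_iff)
  have r: "0 \<le> b - 2 * r * (cmod z)\<^sup>2 + r\<^sup>2 * (cmod z)\<^sup>2 * a" for r
  proof -
    let ?c = "- of_real r * z" and ?w = "1 *s v + (- of_real r * z) *s u"
    have "sesq X ?w ?w = sesq X v v + ?c * cnj z + cnj ?c * z + cnj ?c * ?c * of_real a"
      unfolding sesq_combination zc aa z_def[symmetric] by (simp only: complex_cnj_one mult_1_left mult_1_right)
    also have "Re \<dots> = b - 2 * r * (cmod z)\<^sup>2 + r\<^sup>2 * (cmod z)\<^sup>2 * a"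
      unfolding cmod_power2 by (simp add: b_def) (simp add: power2_eq_square algebra_simps)
    finally show ?thesis
      using pos[of ?w] by simp
  qed
  have "(cmod z)\<^sup>2 \<le> a * b"
  proof (cases "z = 0")
    case True
    then show ?thesis
      using pos by (simp add: a_def b_def)
  next
    case False
    then have z: "0 < (cmod z)\<^sup>2"
      by simp
    have "a \<noteq> 0"
    proof
      assume "a = 0"
      then show False
        \<comment> \<open>With a = 0 this r turns the bound into 0 \<le> b - (b + 1).\<close>
        using r[of "(b + 1) / (2 * (cmod z)\<^sup>2)"] z by simp
    qed
    then have "0 < a"
      using pos[of u] by (simp add: a_def)
    then show ?thesis
      using r[of "1 / a"] by (simp add: field_simps power2_eq_square)
  qed
  then show ?thesis
    by (simp add: z_def a_def b_def)
qed

lemma pos_semidef_entry_bound: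
  "pos_semidef X \<Longrightarrow> (cmod (X $ i $ j))\<^sup>2 \<le> Re (X $ i $ i) * Re (X $ j $ j)"
  using pos_semidef_Cauchy_Schwarz[of X "axis i 1" "axis j 1"] by (simp add: sesq_axis)

lemma pos_semidef_diag_nonneg: "pos_semidef X \<Longrightarrow> 0 \<le> Re (X $ i $ i)"
  unfolding pos_semidef_iff by (metis sesq_axis)

lemma inner_self_complex_matrix: "X \<bullet> X = (\<Sum>i\<in>UNIV. \<Sum>j\<in>UNIV. (cmod (X $ i $ j))\<^sup>2)"
  for X :: "complex^'n^'n"
  by (simp add: inner_vec_def dot_square_norm)

lemma Re_trace_square:
  "(Re (trace X))\<^sup>2 = (\<Sum>i\<in>UNIV. \<Sum>j\<in>UNIV. Re (X $ i $ i) * Re (X $ j $ j))"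
  by (simp add: trace_def power2_eq_square sum_product)

text \<open>Summed over all entries, the nonnegativity of the principal 2 x 2 minors gives the
  bound; eigenvalues do not enter.\<close>

lemma pos_semidef_inner_le_trace: "pos_semidef X \<Longrightarrow> X \<bullet> X \<le> (Re (trace X))\<^sup>2"
  unfolding inner_self_complex_matrix Re_trace_square
  by (intro sum_mono pos_semidef_entry_bound)

text \<open>Equality of the sums forces equality in every entry bound, so all principal 2 x 2 minors
  vanish. Isotropic vectors of a semidefinite form lie in its kernel, and this makes every row a
  multiple of one row with nonzero diagonal entry.\<close>

lemma rank_eq_one_if_trace_eq:
  fixes X :: "complex^'n^'n"
  assumes X: "pos_semidef X" and eq: "X \<bullet> X = (Re (trace X))\<^sup>2" and "X \<noteq> 0"
  shows "rank X = 1"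
proof -
  have herm: "hermitian X"
    using X by (simp add: pos_semidef_iff)
  have "(\<Sum>i\<in>UNIV. \<Sum>j\<in>UNIV. Re (X $ i $ i) * Re (X $ j $ j) - (cmod (X $ i $ j))\<^sup>2) = 0"
    using eq by (simp add: inner_self_complex_matrix Re_trace_square sum_subtractf)
  then have minor: "(cmod (X $ i $ j))\<^sup>2 = Re (X $ i $ i) * Re (X $ j $ j)" for i j
    using pos_semidef_entry_bound[OF X]
    by (simp add: sum_nonneg_eq_0_iff sum_nonneg)
  obtain i j where "X $ i $ j \<noteq> 0"
    using \<open>X \<noteq> 0\<close> by (auto simp: vec_eq_iff)
  then obtain k where k: "Re (X $ k $ k) \<noteq> 0"
    using minor[of i j] by (metis mult_zero_left norm_eq_zero power_eq_0_iff)
  have real_diag: "X $ i $ i = of_real (Re (X $ i $ i))" for i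
    using hermitian_cnj[OF herm, of i i] by (simp add: complex_eq_iff)
  have row: "X $ b $ a * X $ k $ k = X $ b $ k * X $ k $ a" for a b
  proof -
    \<comment> \<open>\<open>v\<close> is isotropic for the form of \<open>X\<close>, hence in the kernel of \<open>X\<close>.\<close>
    define v where "v = X $ k $ k *s axis a 1 + (- X $ k $ a) *s axis k 1"
    have "sesq X v v = X $ k $ k * (X $ a $ a * X $ k $ k - X $ a $ k * cnj (X $ a $ k))"
      unfolding v_def sesq_combination sesq_axis by (simp add: hermitian_cnj[OF herm] algebra_simps)
    also have "X $ a $ k * cnj (X $ a $ k) = of_real (Re (X $ a $ a) * Re (X $ k $ k))"
      unfolding minor[symmetric] by (simp only: complex_norm_square)
    also have "\<dots> = X $ a $ a * X $ k $ k"
      by (simp only: of_real_mult real_diag[symmetric])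
    finally have "sesq X v v = 0"
      by simp
    then have "sesq X (axis b 1) v = 0"
      using pos_semidef_Cauchy_Schwarz[OF X, of "axis b 1" v] by simp
    then show ?thesis
      unfolding v_def sesq_add sesq_scale sesq_axis by (simp add: mult.commute)
  qed
  have kk: "X $ k $ k \<noteq> 0"
    using k by auto
  then have "row k X \<noteq> 0"
    by (metis row_def vec_lambda_eta zero_index)
  have row_b: "row b X = (X $ b $ k / X $ k $ k) *s row k X" for b
    unfolding vec_eq_iff row_def using row[of b] kk by (simp add: nonzero_eq_divide_eq)
  have "rows X \<subseteq> vec.span {row k X}"
  proof
    fix r
    assume "r \<in> rows X"
    then obtain b where "r = row b X"
      by (auto simp: rows_def)
    then have "r = (X $ b $ k / X $ k $ k) *s row k X"
      using row_b by (rule trans)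
    then show "r \<in> vec.span {row k X}"
      by (simp only: vec.span_scale vec.span_base singletonI)
  qed
  moreover have "row k X \<in> rows X"
    by (auto simp: rows_def)
  ultimately have "vec.span (rows X) = vec.span {row k X}"
    by (intro antisym vec.span_minimal vec.span_mono vec.subspace_span) auto
  then have "vec.dim (rows X) = vec.dim {row k X}"
    by (metis vec.dim_span)
  also have "\<dots> = 1"
    using \<open>row k X \<noteq> 0\<close> by (simp add: vec.dim_eq_card_independent)
  finally show ?thesis
    by (simp add: row_rank_def_gen)
qed

text \<open>Replaces the complex traces in \<open>is_SIC\<close> and in the Born rule by the real
  inner product on matrices, for which Gram matrices and the Cauchy-Schwarz inequality are at
  hand.\<close>

lemma trace_hermitian_mult:
  fixes X Y :: "complex^'n^'n"
  assumes X: "hermitian X" and Y: "hermitian Y"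
  shows "trace (X ** Y) = of_real (X \<bullet> Y)"
proof -
  have tr: "trace (X ** Y) = (\<Sum>i\<in>UNIV. \<Sum>j\<in>UNIV. X $ i $ j * cnj (Y $ i $ j))"
    by (simp add: trace_def matrix_matrix_mult_def hermitian_cnj[OF Y])
  have "cnj (trace (X ** Y)) = trace (Y ** X)"
    unfolding tr by (simp add: trace_def matrix_matrix_mult_def hermitian_cnj[OF X] mult.commute)
  then have "cnj (trace (X ** Y)) = trace (X ** Y)"
    by (simp only: trace_mul_sym[of Y X])
  then have "Im (trace (X ** Y)) = 0"
    by (simp add: complex_eq_iff)
  moreover have "Re (trace (X ** Y)) = X \<bullet> Y"
    unfolding tr by (simp add: inner_vec_def inner_complex_def)
  ultimately show ?thesis
    by (simp add: complex_eq_iff)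
qed

lemma hermitian_mat_1: "hermitian (mat 1)"
  by (simp add: hermitian_def conj_transpose_def mat_def vec_eq_iff)

lemma Re_trace_eq_inner: "Re (trace X) = X \<bullet> mat 1"
proof -
  have "X \<bullet> mat 1 = (\<Sum>i\<in>UNIV. \<Sum>j\<in>UNIV. if j = i then Re (X $ i $ i) else 0)"
    unfolding inner_vec_def by (intro sum.cong refl) (auto simp: mat_def inner_complex_def)
  then show ?thesis
    by (simp add: trace_def)
qed

lemma inner_mat_1_self: "(mat 1 :: complex^'n^'n) \<bullet> mat 1 = CARD('n)"
  by (simp add: Re_trace_eq_inner[symmetric] trace_I)

text \<open>Here x stands for d and t for a Kronecker delta. The first and last identities translate
  between the SIC traces and the normalized matrix being the identity; the second is equality in tr
  X^2 \<le> (tr X)^2, and the third the sum of a row of the Gram matrix.\<close>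

lemma sic_gram_identities:
  fixes x t :: real
  assumes x: "0 < x"
  shows "(t + 1 / x) / (x * (x + 1)) = 1 / x\<^sup>2 * ((x * t + 1) / (x + 1))"
    and "1 / x\<^sup>2 * ((x * 1 + 1) / (x + 1)) = (1 / x)\<^sup>2"
    and "1 / x\<^sup>2 * ((x + x\<^sup>2) / (x + 1)) = 1 / x"
    and "(x + 1) * (1 / x\<^sup>2 * ((x * t + 1) / (x + 1))) / (1 / x) - 1 / x = t"
proof -
  have x1: "x + 1 \<noteq> 0"
    using x by simp
  have "t + 1 / x = (x * t + 1) / x"
    using x by (simp add: field_simps)
  then show "(t + 1 / x) / (x * (x + 1)) = 1 / x\<^sup>2 * ((x * t + 1) / (x + 1))"
    by (simp add: power2_eq_square)
  show "1 / x\<^sup>2 * ((x * 1 + 1) / (x + 1)) = (1 / x)\<^sup>2"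
    using x1 by (simp add: power2_eq_square)
  have "x + x\<^sup>2 = x * (x + 1)"
    by (simp add: power2_eq_square algebra_simps)
  then show "1 / x\<^sup>2 * ((x + x\<^sup>2) / (x + 1)) = 1 / x"
    using x1 by (simp add: power2_eq_square)
  have "(x + 1) * (1 / x\<^sup>2 * ((x * t + 1) / (x + 1))) = (x * t + 1) / x\<^sup>2"
    using x1 by simp
  then show "(x + 1) * (1 / x\<^sup>2 * ((x * t + 1) / (x + 1))) / (1 / x) - 1 / x = t"
    using x by (simp add: power2_eq_square field_simps)
qed

section \<open>The Gram determinant and its maximum at SICs\<close>

definition gram :: "('m::finite \<Rightarrow> complex^'n^'n) \<Rightarrow> real^'m^'m" where
  "gram H = (\<chi> i j. H i \<bullet> H j)"

text \<open>The scaled determinant factors as det A times the product of the d * w i (fact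
  \<open>key\<close>). Each factor is positive and at most 1 by the mean inequality, so the product
  is 1 only if A is the identity and every w i is 1 / d, which are the SIC conditions.\<close>

lemma is_MIC_gram:
  fixes H :: "'m::finite \<Rightarrow> complex^'n^'n"
  assumes MIC: "is_MIC H"
  defines "d \<equiv> CARD('n)" and "N \<equiv> CARD('m)"
  shows det_gram_pos: "0 < det (gram H)"
    and det_gram_le: "det (gram H) * (real (d + 1) ^ (N - 1) * real d ^ N) \<le> 1"
    and det_gram_eq_iff: "det (gram H) * (real (d + 1) ^ (N - 1) * real d ^ N) = 1 \<longleftrightarrow> is_SIC H"
proof -
  have N: "N = d\<^sup>2" and psd: "\<And>i. pos_semidef (H i)" and sum1: "(\<Sum>i\<in>UNIV. H i) = mat 1"
    and inj: "inj H" and ind: "independent (range H)"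
    using MIC by (auto simp: is_MIC_def N_def d_def)
  have d0: "0 < d"
    by (simp add: d_def)
  then have d0': "0 < real d"
    by simp
  have d1: "real (d + 1) = real d + 1"
    by simp
  have herm: "hermitian (H i)" for i
    using psd by (simp add: pos_semidef_iff)
  have indep: "x = 0" if "(\<Sum>i\<in>UNIV. x $ i *\<^sub>R H i) = 0" for x :: "real^'m"
  proof -
    have "(\<Sum>v\<in>range H. x $ inv H v *\<^sub>R v) = 0"
      using that inj by (simp add: sum.reindex)
    then have "x $ inv H v = 0" if "v \<in> range H" for v
      using independentD[OF ind _ subset_refl] that by simp
    from this[OF rangeI] show ?thesis
      using inj by (simp add: vec_eq_iff)
  qed
  have H0: "H i \<noteq> 0" for i
    using ind dependent_zero by (metis rangeI)
  define w where "w i = Re (trace (H i))" for i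
  have w_inner: "w i = H i \<bullet> mat 1" for i
    by (simp add: w_def Re_trace_eq_inner)
  have w_nonneg: "0 \<le> w i" for i
    using pos_semidef_diag_nonneg[OF psd] by (simp add: w_def trace_def sum_nonneg)
  have HH: "H i \<bullet> H i \<le> (w i)\<^sup>2" for i
    unfolding w_def by (rule pos_semidef_inner_le_trace[OF psd])
  have w: "0 < w i" for i
  proof -
    have "0 < H i \<bullet> H i"
      using H0 by simp
    then have "0 < (w i)\<^sup>2"
      using HH[of i] by linarith
    then show ?thesis
      using w_nonneg[of i] by (simp add: zero_less_power2)
  qed
  have sum_w: "(\<Sum>i\<in>UNIV. w i) = d"
    unfolding w_inner by (simp add: inner_sum_left[symmetric] sum1 inner_mat_1_self d_def)
  have sum_G: "(\<Sum>j\<in>UNIV. H i \<bullet> H j) = w i" for i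
    by (simp add: inner_sum_right[symmetric] sum1 w_inner)
  have gram_form: "x \<bullet> (gram H *v x) = (\<Sum>i\<in>UNIV. x $ i *\<^sub>R H i) \<bullet> (\<Sum>i\<in>UNIV. x $ i *\<^sub>R H i)" for x
    by (simp add: gram_def inner_vec_def[of x] matrix_vector_mult_def inner_sum_left inner_sum_right
        sum_distrib_left mult_ac) (simp add: inner_commute)
  show "0 < det (gram H)"
  proof (rule det_pos_def_pos)
    show "transpose (gram H) = gram H"
      by (simp add: gram_def transpose_def inner_commute)
    show "0 < x \<bullet> (gram H *v x)" if "x \<noteq> 0" for x
      unfolding gram_form using indep[of x] that by auto
  qed
  define v where "v = (\<chi> i. sqrt (w i))"
  have v: "0 < v $ i" "v $ i * v $ i = w i" for i
    using w[of i] by (auto simp: v_def)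
  have vv: "v \<bullet> v = d"
    by (simp add: inner_vec_def v sum_w)
  \<comment> \<open>The normalized Gram matrix has \<open>v\<close> as eigenvector for the eigenvalue \<open>1\<close>. Replacing that eigenvalue
    by \<open>1 / (d + 1)\<close>, its value on the complement for a SIC, and multiplying by \<open>d + 1\<close> gives \<open>A\<close>.\<close>
  define A where "A = (\<chi> i j. (d + 1) * (H i \<bullet> H j) / (v $ i * v $ j) - v $ i * v $ j)"
  define D where "D c = (\<chi> i j. if i = j then c / v $ i else 0)" for c :: real
  define U where "U = (\<chi> i j. (if i = j then 1 else 0) - 1 / (d + 1) * (v $ i * v $ j))"
  \<comment> \<open>The two diagonal factors produce d + 1 times the normalized Gram matrix. That
    matrix fixes \<open>v\<close> (this is \<open>sum_G\<close>), so multiplying by \<open>U\<close>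
    subtracts exactly v v^T. \<open>U\<close> itself scales \<open>v\<close> by 1 / (d + 1).\<close>
  have A_eq: "A = D (d + 1) ** gram H ** D 1 ** U"
  proof -
    have DGD: "(D (d + 1) ** gram H ** D 1) $ i $ k = (d + 1) * (H i \<bullet> H k) / (v $ i * v $ k)" for i k
      by (simp add: matrix_matrix_mult_def D_def gram_def if_distrib if_distribR cong: if_cong)
    have "(D (d + 1) ** gram H ** D 1 ** U) $ i $ j = A $ i $ j" for i j
    proof -
      have "(D (d + 1) ** gram H ** D 1 ** U) $ i $ j
          = (\<Sum>k\<in>UNIV. (d + 1) * (H i \<bullet> H k) / (v $ i * v $ k)
              * ((if k = j then 1 else 0) - 1 / (d + 1) * (v $ k * v $ j)))"
        unfolding matrix_matrix_mult_def[of _ U] by (simp only: DGD vec_lambda_beta U_def)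
      also have "\<dots> = (\<Sum>k\<in>UNIV. (if k = j then (d + 1) * (H i \<bullet> H j) / (v $ i * v $ j) else 0)
          - v $ j / v $ i * (H i \<bullet> H k))"
      proof (intro sum.cong refl)
        fix k
        have "e * g / (a * b) * (t - 1 / e * (b * c)) = t * (e * g / (a * b)) - c / a * g"
          if "e \<noteq> 0" "a \<noteq> 0" "b \<noteq> 0" for a b c e g t :: real
          using that by (simp add: field_simps)
        from this[of "real (d + 1)" "v $ i" "v $ k" "H i \<bullet> H k" "if k = j then 1 else 0" "v $ j"]
        show "(d + 1) * (H i \<bullet> H k) / (v $ i * v $ k) * ((if k = j then 1 else 0) - 1 / (d + 1) * (v $ k * v $ j))
            = (if k = j then (d + 1) * (H i \<bullet> H j) / (v $ i * v $ j) else 0) - v $ j / v $ i * (H i \<bullet> H k)"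
          using v(1)[of i] v(1)[of k] by (cases "k = j") auto
      qed
      also have "\<dots> = (d + 1) * (H i \<bullet> H j) / (v $ i * v $ j) - v $ j / v $ i * w i"
        unfolding sum_subtractf sum_distrib_left[symmetric] sum_G by simp
      also have "v $ j / v $ i * w i = v $ i * v $ j"
        using v(1)[of i] by (simp add: v(2)[symmetric])
      finally show ?thesis
        by (simp add: A_def)
    qed
    then show ?thesis
      by (simp add: vec_eq_iff)
  qed
  have det_D: "det (D c) = (\<Prod>i\<in>UNIV. c / v $ i)" for c
    unfolding D_def by (subst det_diagonal) auto
  have det_U: "det U = 1 / (d + 1)"
    unfolding U_def det_rank_one_update vv by (simp add: field_simps)
  have "det A = (\<Prod>i\<in>UNIV. (d + 1) / v $ i) * (\<Prod>i\<in>UNIV. 1 / v $ i) * det (gram H) / (d + 1)"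
    by (simp add: A_eq det_mul det_D det_U)
  also have "(\<Prod>i\<in>UNIV. (d + 1) / v $ i) * (\<Prod>i\<in>UNIV. 1 / v $ i) = (\<Prod>i\<in>UNIV. (d + 1) / w i)"
    by (simp add: prod.distrib[symmetric] v(2)[symmetric])
  also have "\<dots> = (d + 1) ^ N / (\<Prod>i\<in>UNIV. w i)"
    by (simp add: prod_dividef N_def)
  also have "real ((d + 1) ^ N) = real (d + 1) ^ (N - 1) * real (d + 1)"
    by (metis N_def of_nat_power power_minus_mult zero_less_card_finite)
  finally have "det A * (\<Prod>i\<in>UNIV. w i) = det (gram H) * real (d + 1) ^ (N - 1)"
  proof -
    assume "det A = real (d + 1) ^ (N - 1) * real (d + 1) / (\<Prod>i\<in>UNIV. w i) * det (gram H) / real (d + 1)"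
    moreover have "w i \<noteq> 0" for i
      using w[of i] by simp
    ultimately show ?thesis
      by simp
  qed
  moreover have "(\<Prod>i\<in>UNIV. d * w i) = d ^ N * (\<Prod>i\<in>UNIV. w i)"
    by (simp add: prod.distrib N_def)
  ultimately have key: "det (gram H) * (real (d + 1) ^ (N - 1) * real d ^ N) = det A * (\<Prod>i\<in>UNIV. d * w i)"
    by (simp add: mult_ac)
  have A_sym: "transpose A = A"
    by (simp add: A_def transpose_def inner_commute mult.commute)
  have A_pos: "0 < x \<bullet> (A *v x)" if "x \<noteq> 0" for x
  proof -
    \<comment> \<open>In terms of h the form of A is (d + 1) |h|^2 - (tr h)^2. Cauchy-Schwarz
      against the identity matrix, of squared norm d, leaves at least |h|^2.\<close>
    define y where "y = (\<chi> i. x $ i / v $ i)"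
    define h where "h = (\<Sum>i\<in>UNIV. y $ i *\<^sub>R H i)"
    have "y \<noteq> 0"
      using that v(1) by (auto simp: y_def vec_eq_iff less_imp_neq[THEN not_sym])
    then have h: "0 < h \<bullet> h"
      using indep[of y] by (auto simp: h_def)
    have tr_h: "h \<bullet> mat 1 = (\<Sum>i\<in>UNIV. x $ i * v $ i)"
      using v(1) by (simp add: h_def inner_sum_left w_inner[symmetric] y_def v(2)[symmetric]
          less_imp_neq[THEN not_sym])
    have form: "x \<bullet> (M *v x) = (\<Sum>i\<in>UNIV. \<Sum>j\<in>UNIV. x $ i * (M $ i $ j * x $ j))"
      for M :: "real^'m^'m" and x
      by (simp add: inner_vec_def matrix_vector_mult_def sum_distrib_left)
    have "x \<bullet> (A *v x) = (\<Sum>i\<in>UNIV. \<Sum>j\<in>UNIV.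
        (d + 1) * (y $ i * (gram H $ i $ j * y $ j)) - (x $ i * v $ i) * (x $ j * v $ j))"
      unfolding form by (intro sum.cong refl) (simp add: A_def y_def gram_def algebra_simps)
    also have "\<dots> = (d + 1) * (y \<bullet> (gram H *v y)) - (h \<bullet> mat 1) * (h \<bullet> mat 1)"
      unfolding form tr_h sum_product by (simp only: sum_subtractf sum_distrib_left)
    also have "\<dots> = (d + 1) * (h \<bullet> h) - (h \<bullet> mat 1)\<^sup>2"
      unfolding gram_form h_def by (simp only: power2_eq_square)
    finally have "x \<bullet> (A *v x) = (d + 1) * (h \<bullet> h) - (h \<bullet> mat 1)\<^sup>2" .
    moreover have "(h \<bullet> mat 1)\<^sup>2 \<le> (h \<bullet> h) * d"
      using Cauchy_Schwarz_ineq[of h "mat 1"] by (simp add: inner_mat_1_self d_def)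
    moreover have "(d + 1) * (h \<bullet> h) = (h \<bullet> h) * d + h \<bullet> h"
      by (simp add: algebra_simps)
    ultimately show ?thesis
      using h by linarith
  qed
  have trace_A: "trace A \<le> CARD('m)"
  proof -
    \<comment> \<open>The bound on tr X^2 enters here: a diagonal entry of A is at most d * w i, and
      these sum to d^2.\<close>
    have "A $ i $ i \<le> (d + 1) * w i - w i" for i
      using HH[of i] w[of i] by (simp add: A_def v divide_le_eq power2_eq_square)
    then have "trace A \<le> (\<Sum>i\<in>UNIV. (d + 1) * w i - w i)"
      unfolding trace_def by (rule sum_mono)
    also have "\<dots> = (\<Sum>i\<in>UNIV. d * w i)"
      by (simp add: algebra_simps)
    also have "\<dots> = CARD('m)"
      using N by (simp add: sum_distrib_left[symmetric] sum_w N_def power2_eq_square)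
    finally show ?thesis .
  qed
  note det_A = det_pos_def_pos[OF A_sym A_pos] det_pos_def_le_one[OF A_sym A_pos trace_A]
    det_pos_def_eq_one[OF A_sym A_pos trace_A]
  have sum_dw: "(\<Sum>i\<in>UNIV. d * w i) \<le> card (UNIV :: 'm set)"
    using N by (simp add: sum_distrib_left[symmetric] sum_w N_def power2_eq_square)
  have dw: "0 < d * w i" for i
    using w[of i] d0 by simp
  note prod_w = prod_le_one_if_sum_le_card[OF finite_class.finite_UNIV dw sum_dw]
  have prod_w_pos: "0 < (\<Prod>i\<in>UNIV. d * w i)"
    by (intro prod_pos dw)
  show "det (gram H) * (real (d + 1) ^ (N - 1) * real d ^ N) \<le> 1"
    unfolding key using det_A prod_w(1) prod_w_pos by (intro mult_le_one) auto
  show "det (gram H) * (real (d + 1) ^ (N - 1) * real d ^ N) = 1 \<longleftrightarrow> is_SIC H"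
  proof
    assume "det (gram H) * (real (d + 1) ^ (N - 1) * real d ^ N) = 1"
    then have prod1: "det A * (\<Prod>i\<in>UNIV. d * w i) = 1"
      by (simp only: key)
    then have "1 \<le> det A"
      using mult_left_mono[OF prod_w(1), of "det A"] det_A(1) by simp
    then have A1: "A = mat 1" and "(\<Prod>i\<in>UNIV. d * w i) = 1"
      using det_A prod1 by auto
    then have "d * w i = 1" for i
      using prod_w(2)[OF _ UNIV_I] by blast
    then have wd: "w i = 1 / d" for i
      using d0 by (simp add: field_simps)
    have v_d: "v $ i * v $ j = 1 / d" for i j
      using d0 by (simp add: v_def wd real_sqrt_divide)
    have G: "H i \<bullet> H j = 1 / (real d)\<^sup>2 * ((real d * (if i = j then 1 else 0) + 1) / (real d + 1))" for i j
    proof -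
      have "A $ i $ j = (if i = j then 1 else 0)"
        by (simp add: A1 mat_def)
      then have "(d + 1) * (H i \<bullet> H j) * d - 1 / d = (if i = j then 1 else 0)"
        by (simp add: A_def v_d)
      then have "(H i \<bullet> H j) * (d * (d + 1)) = (if i = j then 1 else 0) + 1 / d"
        by (simp add: algebra_simps split: if_splits)
      moreover have "real (d * (d + 1)) \<noteq> 0"
        using d0 by (simp only: of_nat_eq_0_iff mult_eq_0_iff) simp
      ultimately have "H i \<bullet> H j = ((if i = j then 1 else 0) + 1 / d) / (d * (d + 1))"
        by (intro eq_divide_imp)
      then show ?thesis
        using sic_gram_identities(1)[OF d0', of "if i = j then 1 else 0"]
        by (simp only: of_nat_mult of_nat_power d1)
    qed
    show "is_SIC H"
      unfolding is_SIC_def d_def[symmetric]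
    proof (intro conjI allI MIC)
      fix i
      have "H i \<bullet> H i = (1 / d)\<^sup>2"
        using sic_gram_identities(2)[OF d0'] by (simp only: G refl if_True)
      then show "rank (H i) = 1"
        using wd[of i] by (intro rank_eq_one_if_trace_eq psd H0) (simp add: w_def)
    next
      fix i j
      have "complex_of_real (H i \<bullet> H j)
          = of_real (1 / (real d)\<^sup>2 * ((real d * (if i = j then 1 else 0) + 1) / (real d + 1)))"
        by (simp only: G)
      then show "trace (H i ** H j) = 1 / of_nat (d\<^sup>2)
          * ((of_nat d * (if i = j then 1 else 0) + 1) / (of_nat d + 1))"
        using trace_hermitian_mult[OF herm herm, of i j] by (simp add: add.commute)
    qed
  next
    assume SIC: "is_SIC H"
    have G: "H i \<bullet> H j = 1 / (real d)\<^sup>2 * ((real d * (if i = j then 1 else 0) + 1) / (real d + 1))" for i j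
    proof -
      have "complex_of_real (H i \<bullet> H j)
          = 1 / of_nat (d\<^sup>2) * ((of_nat d * (if i = j then 1 else 0) + 1) / (of_nat d + 1))"
        using SIC unfolding is_SIC_def trace_hermitian_mult[OF herm herm] d_def by blast
      also have "\<dots> = of_real (1 / (real d)\<^sup>2 * ((real d * (if i = j then 1 else 0) + 1) / (real d + 1)))"
        by (simp add: add.commute)
      finally show ?thesis
        by (simp only: of_real_eq_iff)
    qed
    \<comment> \<open>A SIC prescribes only the traces of products. The trace of H i is recovered as
      the sum of row i of the Gram matrix, since the H j sum to the identity.\<close>
    have wd: "w i = 1 / d" for i
    proof -
      have "w i = (\<Sum>j\<in>UNIV. 1 / (real d)\<^sup>2 * ((real d * (if i = j then 1 else 0) + 1) / (real d + 1)))"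
        unfolding sum_G[symmetric] by (simp only: G)
      also have "\<dots> = 1 / (real d)\<^sup>2 * ((\<Sum>j\<in>UNIV. (if i = j then real d else 0) + 1) / (real d + 1))"
        by (simp only: sum_distrib_left[symmetric] sum_divide_distrib[symmetric])
           (simp add: if_distrib cong: if_cong)
      also have "(\<Sum>j\<in>(UNIV :: 'm set). (if i = j then real d else 0) + 1) = real d + (real d)\<^sup>2"
        using N by (simp add: sum.distrib N_def)
      also have "1 / (real d)\<^sup>2 * ((real d + (real d)\<^sup>2) / (real d + 1)) = 1 / d"
        by (rule sic_gram_identities(3)[OF d0'])
      finally show ?thesis .
    qed
    have v_d: "v $ i * v $ j = 1 / d" for i j
      using d0 by (simp add: v_def wd real_sqrt_divide)
    have "A = mat 1"
      unfolding vec_eq_iff A_def mat_def vec_lambda_beta v_d G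
      using sic_gram_identities(4)[OF d0'] by (simp only: of_nat_power d1) simp
    then have "det A = 1"
      by simp
    moreover have "(\<Prod>i\<in>UNIV. d * w i) = 1"
      using d0 by (simp add: wd)
    ultimately show "det (gram H) * (real (d + 1) ^ (N - 1) * real d ^ N) = 1"
      unfolding key by simp
  qed
qed

section \<open>The volume of the Born image\<close>

lemma pos_semidef_scaleR:
  assumes "pos_semidef X" "0 \<le> c"
  shows "pos_semidef (c *\<^sub>R X)"
proof -
  have "hermitian (c *\<^sub>R X)"
    using assms(1) by (simp add: pos_semidef_iff hermitian_def conj_transpose_def vec_eq_iff)
  moreover have "sesq (c *\<^sub>R X) v v = of_real c * sesq X v v" for v
  proof -
    have "(c *\<^sub>R X) $ i $ j = of_real c * X $ i $ j" for i j
      using scaleR_conv_of_real[of c "X $ i $ j"] by simp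
    then show ?thesis
      by (simp add: sesq_def matrix_vector_mult_def sum_distrib_left mult_ac del: vector_scaleR_component)
  qed
  ultimately show ?thesis
    using assms by (simp add: pos_semidef_iff)
qed

text \<open>\<open>\<sigma>\<close> numbers the index type, which connects the coordinates used for
  induction on the size with the matrix type of the theorem.\<close>

definition herm_of :: "('n \<Rightarrow> nat) \<Rightarrow> (nat \<times> nat \<Rightarrow> real) \<Rightarrow> complex^'n^'n" where
  "herm_of \<sigma> x = (\<chi> a b. hmat x (\<sigma> a) (\<sigma> b))"

lemma hermitian_herm_of: "hermitian (herm_of \<sigma> x)"
  by (simp add: hermitian_def conj_transpose_def herm_of_def cnj_hmat vec_eq_iff)

lemma sum_sum_reindex:
  "bij_betw \<sigma> UNIV {..<n} \<Longrightarrow> (\<Sum>a\<in>UNIV. \<Sum>b\<in>UNIV. f (\<sigma> a) (\<sigma> b)) = (\<Sum>i<n. \<Sum>j<n. f i j)"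
  by (simp add: sum.reindex_bij_betw[of \<sigma> UNIV "{..<n}"]
      sum.reindex_bij_betw[of \<sigma> UNIV "{..<n}" "\<lambda>i. \<Sum>j<n. f i j"])

lemma pos_semidef_herm_of:
  fixes \<sigma> :: "'n::finite \<Rightarrow> nat"
  assumes \<sigma>: "bij_betw \<sigma> UNIV {..<n}"
  shows "pos_semidef (herm_of \<sigma> x) \<longleftrightarrow> x \<in> psd_cone n"
proof -
  have form: "sesq (herm_of \<sigma> x) (\<chi> a. z (\<sigma> a)) (\<chi> a. z (\<sigma> a))
      = (\<Sum>i<n. \<Sum>j<n. cnj (z i) * hmat x i j * z j)" for z
    unfolding sum_sum_reindex[OF \<sigma>, symmetric]
    by (simp add: sesq_def matrix_vector_mult_def herm_of_def sum_distrib_left mult.assoc)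
  have "0 \<le> Re (sesq (herm_of \<sigma> x) v v)"
    if "\<And>z. 0 \<le> Re (sesq (herm_of \<sigma> x) (\<chi> a. z (\<sigma> a)) (\<chi> a. z (\<sigma> a)))" for v
  proof -
    have "(\<chi> a. v $ the_inv \<sigma> (\<sigma> a)) = v"
      using \<sigma> by (simp add: vec_eq_iff bij_betw_def the_inv_f_f)
    then show ?thesis
      using that[of "\<lambda>i. v $ the_inv \<sigma> i"] by (simp only:)
  qed
  then have "(\<forall>v. 0 \<le> Re (sesq (herm_of \<sigma> x) v v))
      \<longleftrightarrow> (\<forall>z. 0 \<le> Re (sesq (herm_of \<sigma> x) (\<chi> a. z (\<sigma> a)) (\<chi> a. z (\<sigma> a))))"
    by blast
  then show ?thesis
    unfolding pos_semidef_iff psd_cone_def form by (simp add: hermitian_herm_of)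
qed

lemma hermitian_eq_herm_of:
  fixes \<sigma> :: "'n::finite \<Rightarrow> nat"
  assumes \<sigma>: "inj \<sigma>" and X: "hermitian X"
  shows "\<exists>x. X = herm_of \<sigma> x"
proof -
  define \<tau> where "\<tau> = the_inv \<sigma>"
  have \<tau>: "\<tau> (\<sigma> a) = a" for a
    using \<sigma> by (simp add: \<tau>_def the_inv_f_f)
  have diag: "of_real (Re (X $ a $ a)) = X $ a $ a" for a
    using hermitian_cnj[OF X, of a a] by (simp add: complex_eq_iff)
  define x where "x = (\<lambda>(i, j). if i \<le> j then Re (X $ \<tau> i $ \<tau> j) else Im (X $ \<tau> j $ \<tau> i))"
  have "X $ a $ b = hmat x (\<sigma> a) (\<sigma> b)" for a b
  proof (cases "\<sigma> a" "\<sigma> b" rule: linorder_cases)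
    case equal
    then show ?thesis
      using injD[OF \<sigma> equal] by (simp add: hmat_def x_def \<tau> diag)
  next
    case greater
    then show ?thesis
      by (simp add: hmat_def x_def \<tau> hermitian_cnj[OF X, of b a, symmetric] complex_eq_iff)
  qed (simp add: hmat_def x_def \<tau>)
  then have "X = herm_of \<sigma> x"
    by (simp add: herm_of_def vec_eq_iff)
  then show ?thesis
    by blast
qed

lemma hmat_inner:
  "hmat x i j \<bullet> hmat y i j
    = (if i = j then x (i, i) * y (i, i) else x (i, j) * y (i, j) + x (j, i) * y (j, i))"
  by (auto simp: hmat_def inner_complex_def)

text \<open>The Hilbert--Schmidt norm counts every off-diagonal entry twice.\<close>

definition hs_weight :: "nat \<times> nat \<Rightarrow> real" where
  "hs_weight k = (if fst k = snd k then 1 else 2)"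

text \<open>The entries at (i, j) and (j, i) contribute the same two products. Exchanging the
  summations in one half collects them at a single coordinate.\<close>

lemma herm_of_inner:
  fixes \<sigma> :: "'n::finite \<Rightarrow> nat"
  assumes \<sigma>: "bij_betw \<sigma> UNIV {..<n}"
  shows "herm_of \<sigma> x \<bullet> herm_of \<sigma> y = (\<Sum>k\<in>{..<n} \<times> {..<n}. hs_weight k * x k * y k)"
proof -
  let ?g = "\<lambda>i j. x (i, j) * y (i, j)" and ?o = "\<lambda>i j. if i = j then 0 else x (i, j) * y (i, j)"
  have "herm_of \<sigma> x \<bullet> herm_of \<sigma> y = (\<Sum>i<n. \<Sum>j<n. hmat x i j \<bullet> hmat y i j)"
    unfolding sum_sum_reindex[OF \<sigma>, symmetric] by (simp add: inner_vec_def herm_of_def)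
  also have "\<dots> = (\<Sum>i<n. \<Sum>j<n. ?g i j + ?o j i)"
    unfolding hmat_inner by (intro sum.cong refl) simp
  also have "\<dots> = (\<Sum>i<n. \<Sum>j<n. ?g i j) + (\<Sum>i<n. \<Sum>j<n. ?o j i)"
    by (simp only: sum.distrib)
  also have "(\<Sum>i<n. \<Sum>j<n. ?o j i) = (\<Sum>i<n. \<Sum>j<n. ?o i j)"
    by (rule sum.swap)
  also have "(\<Sum>i<n. \<Sum>j<n. ?g i j) + (\<Sum>i<n. \<Sum>j<n. ?o i j) = (\<Sum>i<n. \<Sum>j<n. ?g i j + ?o i j)"
    by (simp only: sum.distrib)
  also have "\<dots> = (\<Sum>i<n. \<Sum>j<n. hs_weight (i, j) * x (i, j) * y (i, j))"
    by (intro sum.cong refl) (simp add: hs_weight_def)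
  also have "\<dots> = (\<Sum>k\<in>{..<n} \<times> {..<n}. hs_weight k * x k * y k)"
    by (simp add: sum.cartesian_product split_def)
  finally show ?thesis .
qed

text \<open>Each of the n rows has n - 1 off-diagonal weights. This product is the source of the
  power of 2 in the volume.\<close>

lemma prod_hs_weight: "(\<Prod>k\<in>{..<n} \<times> {..<n}. hs_weight k) = 2 ^ (n * (n - 1))"
proof -
  have "(\<Prod>j<n. hs_weight (i, j)) = 2 ^ (n - 1)" if "i < n" for i
  proof -
    have "(\<Prod>j<n. hs_weight (i, j)) = hs_weight (i, i) * (\<Prod>j\<in>{..<n} - {i}. hs_weight (i, j))"
      using that by (intro prod.remove) auto
    also have "(\<Prod>j\<in>{..<n} - {i}. hs_weight (i, j)) = (\<Prod>j\<in>{..<n} - {i}. 2)"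
      by (intro prod.cong) (auto simp: hs_weight_def)
    finally show ?thesis
      using that by (simp add: hs_weight_def)
  qed
  then have "(\<Prod>i<n. \<Prod>j<n. hs_weight (i, j)) = (\<Prod>i<n. 2 ^ (n - 1))"
    by simp
  then show ?thesis
    by (simp add: prod.cartesian_product split_def power_mult[symmetric] mult.commute)
qed

lemma Re_trace_herm_of:
  fixes \<sigma> :: "'n::finite \<Rightarrow> nat"
  assumes \<sigma>: "bij_betw \<sigma> UNIV {..<n}"
  shows "Re (trace (herm_of \<sigma> x)) = (\<Sum>i<n. x (i, i))"
  using sum.reindex_bij_betw[OF \<sigma>, of "\<lambda>i. x (i, i)"] by (simp add: trace_def herm_of_def hmat_def)

text \<open>The factor d / (d^2 - 1)! undoes the radial integral, as sqrt N = d; the product over k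
  is the integral over the positive semidefinite cone, and the two remaining roots form the Jacobian
  of the Born map.\<close>

lemma vol_E_born_image:
  fixes H :: "'m::finite \<Rightarrow> complex^'n^'n"
  assumes MIC: "is_MIC H"
  defines "d \<equiv> CARD('n)"
  shows "vol_E (born_image H)
    = d / fact (d\<^sup>2 - 1) * sqrt (2 ^ (d * (d - 1))) * (\<Prod>k<d. pi ^ k * fact k) * sqrt (det (gram H))"
proof -
  define K where "K = {..<d} \<times> {..<d}"
  have N: "CARD('m) = d\<^sup>2" and psd: "\<And>i. pos_semidef (H i)" and sum1: "(\<Sum>i\<in>UNIV. H i) = mat 1"
    using MIC by (auto simp: is_MIC_def d_def)
  have herm: "hermitian (H i)" for i
    using psd by (simp add: pos_semidef_iff)
  obtain \<sigma> :: "'n \<Rightarrow> nat" where \<sigma>: "bij_betw \<sigma> UNIV {..<d}"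
    using ex_bij_betw_finite_nat[of "UNIV :: 'n set"] by (auto simp: d_def atLeast0LessThan)
  then have inj_\<sigma>: "inj \<sigma>"
    by (simp add: bij_betw_def)
  have "card K = CARD('m)"
    by (simp add: K_def N power2_eq_square)
  then obtain e :: "'m \<Rightarrow> nat \<times> nat" where e: "bij_betw e UNIV K"
    using finite_same_card_bij[of "UNIV :: 'm set" K] by (auto simp: K_def)
  define e' where "e' = the_inv e"
  have e': "e' (e i) = i" for i
    using e by (simp add: e'_def bij_betw_def the_inv_f_f)
  have "\<exists>x. H i = herm_of \<sigma> x" for i
    by (rule hermitian_eq_herm_of[OF inj_\<sigma> herm])
  then obtain h where h: "\<And>i. H i = herm_of \<sigma> (h i)"
    by metis
  \<comment> \<open>Column \<open>k\<close> of the Born map in coordinates; the weight is the one in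
    \<open>herm_of_inner\<close>.\<close>
  define B :: "nat \<times> nat \<Rightarrow> real^'m" where "B k = (\<chi> i. hs_weight k * h i k)" for k
  define \<phi> where "\<phi> x = (\<Sum>k\<in>K. x k *\<^sub>R B k)" for x :: "nat \<times> nat \<Rightarrow> real"
  have \<phi>: "\<phi> x $ i = herm_of \<sigma> x \<bullet> H i" for x i
    unfolding h herm_of_inner[OF \<sigma>] K_def[symmetric] by (simp add: \<phi>_def B_def mult_ac)
  have sum_\<phi>: "(\<Sum>i\<in>UNIV. \<phi> x $ i) = (\<Sum>i<d. x (i, i))" for x
    unfolding \<phi> inner_sum_right[symmetric] sum1 Re_trace_eq_inner[symmetric]
    by (rule Re_trace_herm_of[OF \<sigma>])
  \<comment> \<open>M = L W is the matrix of \<phi>, whereas the Gram matrix is L W L^T. So (det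
    M)^2 is det W times the Gram determinant, and only a square root of the weights
    survives.\<close>
  define M where "M = (\<chi> i j. B (e j) $ i)"
  define W where "W = (\<chi> i j. if i = j then hs_weight (e j) else 0)"
  define L where "L = (\<chi> i j. h i (e j))"
  have M_eq: "M = L ** W"
    by (simp add: vec_eq_iff M_def L_def W_def B_def matrix_matrix_mult_def if_distrib mult.commute cong: if_cong)
  have gram_eq: "gram H = M ** transpose L"
  proof -
    have "H i \<bullet> H j = (\<Sum>k\<in>UNIV. hs_weight (e k) * h i (e k) * h j (e k))" for i j
      unfolding h herm_of_inner[OF \<sigma>] K_def[symmetric] by (rule sum.reindex_bij_betw[OF e, symmetric])
    then show ?thesis
      by (simp add: vec_eq_iff gram_def M_def L_def B_def matrix_matrix_mult_def transpose_def)
  qed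
  have det_W: "det W = 2 ^ (d * (d - 1))"
  proof -
    have "det W = (\<Prod>i\<in>UNIV. hs_weight (e i))"
      unfolding W_def by (subst det_diagonal) auto
    also have "\<dots> = (\<Prod>k\<in>K. hs_weight k)"
      by (rule prod.reindex_bij_betw[OF e])
    finally show ?thesis
      by (simp only: K_def prod_hs_weight)
  qed
  have "(det M)\<^sup>2 = 2 ^ (d * (d - 1)) * det (gram H)"
    unfolding gram_eq M_eq det_mul det_W det_transpose by (simp add: power2_eq_square)
  then have abs_det: "\<bar>det M\<bar> = sqrt (2 ^ (d * (d - 1))) * sqrt (det (gram H))"
    by (metis real_sqrt_abs real_sqrt_mult)
  have "0 < \<bar>det M\<bar>"
    unfolding abs_det using det_gram_pos[OF MIC] by simp
  then have det_M: "det M \<noteq> 0"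
    by simp
  then obtain M' where M': "M ** M' = mat 1" "M' ** M = mat 1"
    using invertible_det_nz[of M] by (auto simp: invertible_def)
  have \<phi>_M: "\<phi> x = M *v (\<chi> i. x (e i))" for x
    unfolding \<phi>_def
    by (subst sum.reindex_bij_betw[OF e, symmetric])
       (simp add: vec_eq_iff matrix_vector_mult_def M_def mult.commute)
  \<comment> \<open>Inverse of \<phi> on the coordinates in \<open>K\<close>. The values elsewhere
    are arbitrary, which membership in \<open>psd_cone d\<close> ignores.\<close>
  define \<psi> where "\<psi> p = (\<lambda>k. (M' *v p) $ e' k)" for p
  have \<phi>_\<psi>: "\<phi> (\<psi> p) = p" for p
    by (simp add: \<phi>_M \<psi>_def e' matrix_vector_mul_assoc M'(1))
  have \<psi>_\<phi>: "\<psi> (\<phi> x) k = x k" if k: "k \<in> K" for x k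
  proof -
    obtain i where "k = e i"
      using k bij_betw_imp_surj_on[OF e] by blast
    then show ?thesis
      by (simp add: \<phi>_M \<psi>_def e' matrix_vector_mul_assoc M'(2))
  qed
  \<comment> \<open>The cone over the Born image, written as a preimage under a continuous map so
    that it is visibly closed.\<close>
  define C where "C = \<psi> -` psd_cone d"
  have \<phi>_C: "\<phi> x \<in> C \<longleftrightarrow> x \<in> psd_cone d" for x
  proof -
    have "\<psi> (\<phi> x) \<in> psd_cone d \<longleftrightarrow> x \<in> psd_cone d"
      by (rule psd_cone_cong) (simp add: \<psi>_\<phi> K_def)
    then show ?thesis
      by (simp add: C_def)
  qed
  have "continuous_on UNIV \<psi>"
    unfolding \<psi>_def by (intro continuous_on_coordinatewise_then_product continuous_intros)
  then have "closed C"
    unfolding C_def using closed_psd_cone continuous_on_closed_vimage[of UNIV \<psi>] by auto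
  have C: "C \<in> sets borel"
    using \<open>closed C\<close> by (rule borel_closed)
  define f where "f p = indicator C p * ennreal (exp (- (\<Sum>k\<in>UNIV. p $ k)))" for p :: "real^'m"
  have f: "f \<in> borel_measurable borel"
    unfolding f_def using C by measurable
  have "enn2real (integral\<^sup>N lborel f) = fact (CARD('m) - 1) / sqrt CARD('m) * vol_E (born_image H)"
    unfolding f_def
  proof (rule vol_E_cone[OF C])
    fix p
    assume "p \<in> C"
    then have "\<psi> p \<in> psd_cone d"
      by (simp add: C_def)
    then have "0 \<le> (\<Sum>i<d. \<psi> p (i, i))"
      by (intro sum_nonneg psd_cone_diag_nonneg) auto
    then show "0 \<le> (\<Sum>k\<in>UNIV. p $ k)"
      using sum_\<phi>[of "\<psi> p"] by (simp only: \<phi>_\<psi>)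
  next
    fix p :: "real^'m" and t :: real
    assume t: "0 < t" and p: "(\<Sum>k\<in>UNIV. p $ k) = 1"
    have born: "(\<chi> i. Re (trace (\<rho> ** H i))) = (\<chi> i. \<rho> \<bullet> H i)" if "pos_semidef \<rho>" for \<rho>
      using that trace_hermitian_mult[OF _ herm] by (simp add: pos_semidef_iff vec_eq_iff)
    show "t *\<^sub>R p \<in> C \<longleftrightarrow> p \<in> born_image H"
    proof
      assume tp: "t *\<^sub>R p \<in> C"
      define x where "x = \<psi> (t *\<^sub>R p)"
      \<comment> \<open>Division by t normalizes the trace, which equals the coordinate sum of
        \<open>p\<close>.\<close>
      define \<rho> where "\<rho> = (1 / t) *\<^sub>R herm_of \<sigma> x"
      have x: "\<phi> x = t *\<^sub>R p"
        by (simp add: x_def \<phi>_\<psi>)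
      have psd_\<rho>: "pos_semidef \<rho>"
        unfolding \<rho>_def using tp t
        by (intro pos_semidef_scaleR) (simp_all add: pos_semidef_herm_of[OF \<sigma>] x_def C_def)
      have pi: "p = (\<chi> i. \<rho> \<bullet> H i)"
        using x t by (simp add: vec_eq_iff \<phi>[symmetric] \<rho>_def)
      have "Re (trace \<rho>) = \<rho> \<bullet> (\<Sum>i\<in>UNIV. H i)"
        by (simp add: sum1 Re_trace_eq_inner)
      also have "\<dots> = 1"
        using p by (simp add: pi inner_sum_right)
      finally have "Re (trace \<rho>) = 1" .
      moreover have "trace \<rho> = of_real (\<rho> \<bullet> mat 1)"
        using trace_hermitian_mult[OF _ hermitian_mat_1, of \<rho>] psd_\<rho> by (simp add: pos_semidef_iff)
      ultimately have "trace \<rho> = 1"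
        by (simp add: complex_eq_iff)
      then have "\<rho> \<in> density_operators"
        using psd_\<rho> by (simp add: density_operators_def)
      moreover have "p = (\<chi> i. Re (trace (\<rho> ** H i)))"
        unfolding born[OF psd_\<rho>] by (rule pi)
      ultimately show "p \<in> born_image H"
        unfolding born_image_def by (rule rev_image_eqI)
    next
      assume "p \<in> born_image H"
      then obtain \<rho> where \<rho>: "pos_semidef \<rho>" and p: "p = (\<chi> i. \<rho> \<bullet> H i)"
        using born by (auto simp: born_image_def density_operators_def)
      have t\<rho>: "pos_semidef (t *\<^sub>R \<rho>)"
        using \<rho> t by (intro pos_semidef_scaleR) auto
      then obtain x where x: "t *\<^sub>R \<rho> = herm_of \<sigma> x"
        using hermitian_eq_herm_of[OF inj_\<sigma>, of "t *\<^sub>R \<rho>"] unfolding pos_semidef_iff by blast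
      have "\<phi> x = t *\<^sub>R p"
        by (simp add: vec_eq_iff \<phi> x[symmetric] p)
      then show "t *\<^sub>R p \<in> C"
        using \<phi>_C[of x] t\<rho> pos_semidef_herm_of[OF \<sigma>, of x] by (simp only: x)
    qed
  qed
  moreover have "integral\<^sup>N lborel f = ennreal \<bar>det M\<bar> * ennreal (\<Prod>k<d. pi ^ k * fact k)"
  proof -
    have "integral\<^sup>N lborel f = ennreal \<bar>det M\<bar> * (\<integral>\<^sup>+x. f (\<phi> x) \<partial>Pi\<^sub>M K (\<lambda>_. lborel))"
      using nn_integral_lborel_basis[OF e f, of B] det_M unfolding M_def \<phi>_def by blast
    also have "(\<lambda>x. f (\<phi> x)) = (\<lambda>x. indicator (psd_cone d) x * ennreal (exp (- (\<Sum>i<d. x (i, i)))))"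
      unfolding f_def sum_\<phi> by (simp add: indicator_def \<phi>_C)
    finally show ?thesis
      unfolding K_def nn_integral_psd_cone .
  qed
  ultimately have "\<bar>det M\<bar> * (\<Prod>k<d. pi ^ k * fact k) = fact (d\<^sup>2 - 1) / d * vol_E (born_image H)"
    by (simp add: enn2real_mult prod_nonneg N)
  then show ?thesis
    unfolding abs_det by (simp add: field_simps d_def)
qed

text \<open>The exponents add up to n (n - 1) / 2; comparing squares avoids the halving.\<close>

lemma prod_pi_power: "(\<Prod>k<n. pi ^ k) = sqrt (pi ^ (n * (n - 1)))"
proof -
  have "(\<Prod>k<n. pi ^ k)\<^sup>2 = pi ^ (n * (n - 1))"
  proof (induction n)
    case (Suc n)
    have eq: "Suc n * (Suc n - 1) = n * (n - 1) + n * 2"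
      by (cases n) auto
    have "(\<Prod>k<Suc n. pi ^ k)\<^sup>2 = pi ^ (n * (n - 1)) * (pi ^ n)\<^sup>2"
      by (simp only: prod.lessThan_Suc power_mult_distrib Suc)
    then show ?case
      by (simp only: eq power_add power_mult)
  qed simp
  then show ?thesis
    by (intro real_sqrt_unique[symmetric] prod_nonneg) auto
qed

theorem theorem2:
  fixes H S :: "'m::finite \<Rightarrow> complex^'n::finite^'n" and d :: nat
  assumes d: "d = CARD('n)"
    and MIC: "is_MIC H"
    and SIC: "is_SIC S"
  shows "vol_E (born_image H) \<le> vol_E (born_image S)
    \<and> (vol_E (born_image H) = vol_E (born_image S) \<longleftrightarrow> is_SIC H)
    \<and> vol_E (born_image S) =
        sqrt ((2 * pi) ^ (d * (d - 1)) /
              (real d powi (int d ^ 2 - 2) * real (d + 1) ^ (d\<^sup>2 - 1)))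
        * ((\<Prod>k = 1..d. Gamma (real k)) / Gamma (real (d\<^sup>2)))"
proof -
  have MIC_S: "is_MIC S"
    using SIC by (simp add: is_SIC_def)
  have N: "CARD('m) = d\<^sup>2"
    using MIC by (simp add: is_MIC_def d)
  have d0: "0 < d"
    by (simp add: d)
  \<comment> \<open>\<open>c\<close> gathers what depends on d alone, and 1 / \<open>q\<close> is
    the Gram determinant of a SIC, so volumes compare as Gram determinants do.\<close>
  define c where "c = d / fact (d\<^sup>2 - 1) * sqrt (2 ^ (d * (d - 1))) * (\<Prod>k<d. pi ^ k * fact k)"
  define q where "q = real (d + 1) ^ (d\<^sup>2 - 1) * real d ^ d\<^sup>2"
  have c: "0 < c"
    using d0 by (simp add: c_def prod_pos)
  have q: "0 < q"
    using d0 by (simp add: q_def)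
  have vol: "vol_E (born_image T) = c * sqrt (det (gram T))" if "is_MIC T" for T :: "'m \<Rightarrow> complex^'n^'n"
    unfolding vol_E_born_image[OF that] by (simp add: c_def d)
  have "det (gram S) * q = 1"
    using det_gram_eq_iff[OF MIC_S] SIC unfolding N d[symmetric] q_def by blast
  then have det_S: "det (gram S) = 1 / q"
    using q by (intro eq_divide_imp) auto
  have "det (gram H) * q \<le> 1" "det (gram H) * q = 1 \<longleftrightarrow> is_SIC H"
    using det_gram_le[OF MIC] det_gram_eq_iff[OF MIC] unfolding N d[symmetric] q_def by blast+
  then have det_H: "det (gram H) \<le> 1 / q" "det (gram H) = 1 / q \<longleftrightarrow> is_SIC H"
    using q by (simp_all add: le_divide_eq eq_divide_eq)
  have "vol_E (born_image S)
      = sqrt ((2 * pi) ^ (d * (d - 1)) / (real d powi (int d ^ 2 - 2) * real (d + 1) ^ (d\<^sup>2 - 1)))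
        * ((\<Prod>k = 1..d. Gamma (real k)) / Gamma (real (d\<^sup>2)))"
  proof -
    have Gamma_prod: "(\<Prod>k = 1..d. Gamma (real k)) = (\<Prod>k<d. fact k)"
      by (rule prod.reindex_bij_witness[of _ Suc "\<lambda>k. k - 1"])
         (auto simp: Gamma_fact[symmetric] of_nat_diff)
    have Gamma_N: "Gamma (real (d\<^sup>2)) = fact (d\<^sup>2 - 1)"
      using Gamma_fact[of "d\<^sup>2 - 1", where 'a=real] d0 by (simp add: of_nat_diff)
    \<comment> \<open>For d = 1 the exponent is -1, hence the integer power; splitting off d^2
      covers all d.\<close>
    have powi: "real d powi (int d ^ 2 - 2) = real d ^ d\<^sup>2 / (real d)\<^sup>2"
    proof -
      have "real d powi (int (d\<^sup>2) - 2) = real d ^ d\<^sup>2 / (real d)\<^sup>2"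
        using d0 by (subst power_int_diff) (simp_all only: power_int_of_nat power_int_numeral of_nat_eq_0_iff, simp)
      then show ?thesis
        by (simp only: of_nat_power)
    qed
    have "sqrt ((2 * pi) ^ (d * (d - 1)) / (real d powi (int d ^ 2 - 2) * real (d + 1) ^ (d\<^sup>2 - 1)))
        = sqrt (2 ^ (d * (d - 1)) * pi ^ (d * (d - 1)) * ((real d)\<^sup>2 / q))"
      unfolding powi q_def by (simp add: power_mult_distrib mult_ac)
    also have "\<dots> = sqrt (2 ^ (d * (d - 1))) * (\<Prod>k<d. pi ^ k) * (d / sqrt q)"
      by (simp add: real_sqrt_mult real_sqrt_divide prod_pi_power)
    finally show ?thesis
      unfolding vol[OF MIC_S] det_S Gamma_prod Gamma_N
      by (simp add: c_def prod.distrib real_sqrt_divide mult_ac)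
  qed
  moreover have "vol_E (born_image H) \<le> vol_E (born_image S)"
    unfolding vol[OF MIC] vol[OF MIC_S] det_S using c det_H(1) by simp
  moreover have "vol_E (born_image H) = vol_E (born_image S) \<longleftrightarrow> is_SIC H"
    unfolding vol[OF MIC] vol[OF MIC_S] det_S det_H(2)[symmetric] using c by simp
  ultimately show ?thesis
    by blast
qed

end
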